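(* Let $S_n=X_1+\dots+X_n$ be an integer-valued random walk (with i.i.d. increments) such that $\mathbb{E}S_1=0$ and $\mathrm{Var}(S_1)<\infty$. Let $A_n:=\sum_{i=1}^n S_i$, let $\mathcal{D}_{S_1}:=\{n\in\mathbb{N}:\mathbb{P}(S_n=0)>0\}$, and for $N\in\mathcal{D}_{S_1}$ let $$p^*_N:=\mathbb{P}\Bigl\{\min_{1\le k\le N}A_k>0\,\Bigm|\,S_N=0\Bigr\}.$$ Then $p^*_N\lesssim N^{-1/4}$ as $N\to\infty$ along $\mathcal{D}_{S_1}$. Moreover, if $S_1$ is right-continuous, then $p^*_N\asymp N^{-1/4}$ as $N\to\infty$ along $\mathcal{D}_{S_1}$.
   Context: An integer-valued random walk $S_n$ (or its increment $S_1$) is called right-continuous (skip free) if $\mathbb{P}(S_1>0)>0$ and $\mathbb{P}(S_1=1\mid S_1>0)=1$. For non-negative sequences $a_n,b_n$, the notation $a_n\lesssim b_n$ means that $a_n/b_n$ stays bounded, and $a_n\asymp b_n$ means that $a_n\lesssim b_n$ and $b_n\lesssim a_n$ (as $n\to\infty$ along the indicated set of indices). *)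

theory Defs
  imports "HOL-Probability.Probability" "HOL-Library.Landau_Symbols"
begin

text \<open>Increments are indexed from 1; the value \<^term>\<open>X 0\<close> is never used.\<close>

definition walk :: "(nat \<Rightarrow> 'a \<Rightarrow> int) \<Rightarrow> nat \<Rightarrow> 'a \<Rightarrow> int" where
  "walk X n \<omega> = (\<Sum>i=1..n. X i \<omega>)"

definition integrated_walk :: "(nat \<Rightarrow> 'a \<Rightarrow> int) \<Rightarrow> nat \<Rightarrow> 'a \<Rightarrow> int" where
  "integrated_walk X n \<omega> = (\<Sum>i=1..n. walk X i \<omega>)"

definition iid_increments :: "'a measure \<Rightarrow> (nat \<Rightarrow> 'a \<Rightarrow> int) \<Rightarrow> bool" where
  "iid_increments M X \<longleftrightarrow>
     prob_space.indep_vars M (\<lambda>_. count_space UNIV) X {1..} \<and>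
     (\<forall>i\<ge>1. distr M (count_space UNIV) (X i) = distr M (count_space UNIV) (X 1))"

definition right_continuous :: "'a measure \<Rightarrow> ('a \<Rightarrow> int) \<Rightarrow> bool" where
  "right_continuous M Y \<longleftrightarrow>
     \<P>(\<omega> in M. Y \<omega> > 0) > 0 \<and> \<P>(\<omega> in M. Y \<omega> = 1 \<bar> Y \<omega> > 0) = 1"

definition return_times :: "'a measure \<Rightarrow> (nat \<Rightarrow> 'a \<Rightarrow> int) \<Rightarrow> nat set" where
  "return_times M X = {n. n \<ge> 1 \<and> \<P>(\<omega> in M. walk X n \<omega> = 0) > 0}"

definition bridge_persistence :: "'a measure \<Rightarrow> (nat \<Rightarrow> 'a \<Rightarrow> int) \<Rightarrow> nat \<Rightarrow> real" where
  "bridge_persistence M X N =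
     \<P>(\<omega> in M. Min ((\<lambda>k. integrated_walk X k \<omega>) ` {1..N}) > 0 \<bar> walk X N \<omega> = 0)"

text \<open>Tending to infinity along the index set \<open>D\<close>: with respect to this filter,
  \<open>a \<lesssim> b\<close> is the Landau relation \<open>a \<in> O(b)\<close> and \<open>a \<asymp> b\<close> is \<open>a \<in> \<Theta>(b)\<close>.\<close>

definition at_top_along :: "nat set \<Rightarrow> nat filter" where
  "at_top_along D = inf at_top (principal D)"

end

theory Submission
  imports Defs "HOL-Real_Asymp.Real_Asymp"
begin

text \<open>
  Write \<open>S\<close> for the walk, \<open>A\<close> for its area and \<open>u n\<close> for the probability that \<open>S n = 0\<close>; a path of
  length \<open>n\<close> with \<open>S n = 0\<close> is a bridge, and the times \<open>k\<close> with \<open>S k = 0\<close> are its returns. The proof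
  looks at \<open>A\<close> at the returns only. Reading the increments of a bridge backwards preserves its law,
  and if \<open>k\<close> is a return, then the reversed bridge has a return at \<open>n - k\<close> with area \<open>A k - A n\<close>. So the
  event that \<open>A\<close> is positive at all returns after time 0 has the same probability as the event that
  \<open>A n\<close> lies below the area at every earlier return. This symmetry takes the place of symmetric
  increments, and it is what produces the exponent.

  \<^bold>\<open>Upper bound.\<close> Let \<open>w n\<close> be the probability of a bridge with \<open>A > 0\<close> at all returns. Cutting a
  bridge at its minimal area and reversing the first piece shows that the convolution \<open>w * w\<close> is at
  most \<open>u\<close> (\<open>strict_bridge_convolution\<close>). As \<open>u n\<close> is at most of order \<open>n powr (-1/2)\<close>, the partial
  sums of \<open>w\<close> are at most of order \<open>n powr (1/4)\<close>. To pass from sums to single terms, drop the condition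
  \<open>S n = 0\<close>: the resulting probability \<open>q n\<close> decreases in \<open>n\<close>, and cutting at the last return bounds
  it by the convolution of \<open>w\<close> with the probability of no return, whose partial sums are at most of order
  \<open>sqrt n\<close>. Hence \<open>n * q n\<close> is at most of order \<open>n powr (3/4)\<close>. Finally \<open>w n\<close> is at most
  \<open>q (n div 2)\<close> times the probability that the second half of the path hits a prescribed value,
  which gives \<open>w n\<close> of order at most \<open>n powr (-3/4)\<close>; division by \<open>u n\<close> yields the claim.

  \<^bold>\<open>Lower bound.\<close> Let \<open>v n\<close> be the probability of a bridge with \<open>A \<ge> 0\<close> at all returns. The same
  cut now gives \<open>u \<le> v * v\<close> (\<open>weak_bridge_convolution\<close>), so the partial sums of \<open>v\<close> are at least of
  order \<open>n powr (1/4)\<close>. Reversed, \<open>v n\<close> is the probability that the bridge ends at a record low of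
  the area, and records form a renewal structure: \<open>n * v n\<close> dominates the convolution of \<open>v\<close> with
  \<open>h\<close>, where \<open>h k\<close> is the mean length of the first gap between records on the event that \<open>k\<close> is a
  record (\<open>record_renewal_inequality\<close>). Rotating a bridge to the last record that it has relative to
  a level \<open>l\<close> bounds \<open>h k\<close> from below by the mean number of visited levels \<open>l\<close> that lie above the
  average height of the bridge (\<open>record_gap_ge\<close>). A walk with upward steps of size one visits all
  levels between its average and its maximum, that is about \<open>sqrt k\<close> of them, so \<open>h\<close> is bounded away
  from zero and \<open>n * v n\<close> is at least of order \<open>n powr (1/4)\<close>. For such walks every excursion from
  zero is first positive and then negative; therefore \<open>A \<ge> 0\<close> at the returns implies \<open>A \<ge> 0\<close>
  throughout, and one fixed initial excursion of positive area makes the inequality strict.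

  \<^bold>\<open>Return probabilities.\<close> Fourier inversion on the lattice of possible values gives
  \<open>local_limit_estimates\<close>: all point probabilities are at most of order \<open>n powr (-1/2)\<close>, and
  \<open>u n\<close> has exactly this order at the large times \<open>n\<close> that satisfy a divisibility condition, which
  every \<open>n\<close> with \<open>u n > 0\<close> satisfies. The differences of such times satisfy it as well, which is
  what the renewal argument needs.
\<close>

section \<open>Finite sequences of independent steps\<close>

definition pos :: "int list \<Rightarrow> nat \<Rightarrow> int" where
  "pos xs k = sum_list (take k xs)"

definition area :: "int list \<Rightarrow> nat \<Rightarrow> int" where
  "area xs k = (\<Sum>i=1..k. pos xs i)"

lemma pos_0 [simp]: "pos xs 0 = 0"
  by (simp add: pos_def)

lemma pos_length: "length xs \<le> k \<Longrightarrow> pos xs k = sum_list xs"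
  by (simp add: pos_def)

lemma pos_Suc: "k < length xs \<Longrightarrow> pos xs (Suc k) = pos xs k + xs ! k"
  by (simp add: pos_def take_Suc_conv_app_nth)

lemma area_0 [simp]: "area xs 0 = 0"
  by (simp add: area_def)

lemma area_Suc [simp]: "area xs (Suc k) = area xs k + pos xs (Suc k)"
  by (simp add: area_def)

lemma pos_drop: "pos (drop j zs) k = pos zs (j + k) - pos zs j"
  by (simp add: pos_def take_add)

lemma area_drop: "area (drop j zs) k = area zs (j + k) - area zs j - int k * pos zs j"
  by (induction k) (simp_all add: pos_drop algebra_simps)

lemma pos_take: "k \<le> j \<Longrightarrow> pos (take j zs) k = pos zs k"
  by (simp add: pos_def min_absorb2 min_absorb1)

lemma area_take: "k \<le> j \<Longrightarrow> area (take j zs) k = area zs k"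
  by (simp add: area_def pos_take)

lemma pos_append1: "k \<le> length xs \<Longrightarrow> pos (xs @ ys) k = pos xs k"
  by (simp add: pos_def)

lemma area_append1: "k \<le> length xs \<Longrightarrow> area (xs @ ys) k = area xs k"
  by (simp add: area_def pos_append1)

lemma pos_append2: "pos (xs @ ys) (length xs + k) = sum_list xs + pos ys k"
  by (simp add: pos_def)

lemma area_append2:
  "area (xs @ ys) (length xs + k) = area xs (length xs) + int k * sum_list xs + area ys k"
proof (induction k)
  case (Suc k)
  have "area (xs @ ys) (length xs + Suc k) = area (xs @ ys) (length xs + k) + pos (xs @ ys) (length xs + Suc k)"
    by simp
  then show ?case
    unfolding Suc.IH pos_append2 by (simp add: algebra_simps)
qed (simp add: area_append1)

lemma pos_rev:
  assumes "k \<le> length xs"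
  shows "pos (rev xs) k = sum_list xs - pos xs (length xs - k)"
proof -
  have "sum_list xs = sum_list (take (length xs - k) xs) + sum_list (drop (length xs - k) xs)"
    by (metis append_take_drop_id sum_list_append)
  then show ?thesis using assms
    by (simp add: pos_def take_rev sum_list_rev)
qed

text \<open>
  At a return \<open>length xs - k\<close> the last term vanishes, and the reversed path has gained by time \<open>k\<close>
  what the path had at time \<open>length xs - k\<close> in excess of its total area.
\<close>

lemma area_rev:
  assumes "sum_list xs = 0" "k \<le> length xs"
  shows "area (rev xs) k =
    area xs (length xs - k) - area xs (length xs) - pos xs (length xs - k)"
  using assms(2)
proof (induction k)
  case 0
  then show ?case using assms(1) by (simp add: pos_length)
next
  case (Suc k)
  then have eq: "length xs - k = Suc (length xs - Suc k)" by simp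
  have "area xs (length xs - k) = area xs (length xs - Suc k) + pos xs (length xs - k)"
    unfolding eq by simp
  with Suc show ?case
    using assms(1) pos_rev[of "Suc k" xs] by simp
qed

abbreviation lprob :: "int pmf \<Rightarrow> nat \<Rightarrow> int list set \<Rightarrow> real" where
  "lprob p n B \<equiv> measure_pmf.prob (replicate_pmf n p) B"

lemma lprob_mono:
  assumes "\<And>xs. length xs = n \<Longrightarrow> set xs \<subseteq> set_pmf p \<Longrightarrow> xs \<in> A \<Longrightarrow> xs \<in> B"
  shows "lprob p n A \<le> lprob p n B"
proof (rule measure_pmf.finite_measure_mono_AE)
  show "AE xs in measure_pmf (replicate_pmf n p). xs \<in> A \<longrightarrow> xs \<in> B"
    using assms by (auto simp: AE_measure_pmf_iff set_replicate_pmf)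
qed simp

lemma lprob_cong:
  assumes "\<And>xs. length xs = n \<Longrightarrow> set xs \<subseteq> set_pmf p \<Longrightarrow> xs \<in> A \<longleftrightarrow> xs \<in> B"
  shows "lprob p n A = lprob p n B"
  using lprob_mono[of n p A B] lprob_mono[of n p B A] assms by fastforce

lemma integrable_indicator_pmf [simp]:
  "integrable (measure_pmf q) (\<lambda>x. indicator A x :: real)"
  by (rule measure_pmf.integrable_const_bound[where B = 1]) (auto simp: indicator_def)

text \<open>
  The Markov property at time \<open>m\<close>, with a constraint on the second piece that may depend on the
  first piece.
\<close>

lemma lprob_split:
  fixes p :: "int pmf" and m n :: nat
  shows   "lprob p (m + n) {zs. take m zs \<in> A \<and> drop m zs \<in> B \<and> sum_list (drop m zs) \<in> F (take m zs)} =
   (\<integral>xs. indicator A xs * lprob p n {ys\<in>B. sum_list ys \<in> F xs} \<partial>measure_pmf (replicate_pmf m p))"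
  (is "lprob p _ ?E = _")
proof -
  have bind: "measure_pmf.prob (bind_pmf P f) X = (\<integral>x. measure_pmf.prob (f x) X \<partial>measure_pmf P)"
    for P :: "int list pmf" and f :: "int list \<Rightarrow> int list pmf" and X
    unfolding measure_pmf_bind
    by (subst measure_pmf.measure_bind[where N="count_space UNIV"]) (auto simp: measure_subprob)
  have "lprob p (m + n) ?E = (\<integral>xs. measure_pmf.prob (map_pmf (\<lambda>ys. xs @ ys) (replicate_pmf n p)) ?E
      \<partial>measure_pmf (replicate_pmf m p))"
    unfolding replicate_pmf_distrib map_pmf_def by (rule bind)
  also have "\<dots> = (\<integral>xs. indicator A xs * lprob p n {ys\<in>B. sum_list ys \<in> F xs} \<partial>measure_pmf (replicate_pmf m p))"
  proof (rule integral_cong_AE)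
    show "AE xs in measure_pmf (replicate_pmf m p).
        measure_pmf.prob (map_pmf (\<lambda>ys. xs @ ys) (replicate_pmf n p)) ?E
         = indicator A xs * lprob p n {ys\<in>B. sum_list ys \<in> F xs}"
    proof (unfold AE_measure_pmf_iff, intro ballI)
      fix xs assume "xs \<in> set_pmf (replicate_pmf m p)"
      then have "length xs = m" by (auto simp: set_replicate_pmf)
      then have "(\<lambda>ys. xs @ ys) -` ?E = (if xs \<in> A then {ys\<in>B. sum_list ys \<in> F xs} else {})"
        by auto
      then show "measure_pmf.prob (map_pmf (\<lambda>ys. xs @ ys) (replicate_pmf n p)) ?E
         = indicator A xs * lprob p n {ys\<in>B. sum_list ys \<in> F xs}"
        by (simp add: measure_map_pmf)
    qed
  qed auto
  finally show ?thesis .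
qed

lemma lprob_split_prod:
  fixes p :: "int pmf" and m n :: nat
  shows   "lprob p (m + n) {zs. take m zs \<in> A \<and> drop m zs \<in> B} = lprob p m A * lprob p n B"
  using lprob_split[where F = "\<lambda>_. UNIV"] by simp

lemma lprob_split_prod':
  assumes "j \<le> n"
  shows "lprob p n {zs. take j zs \<in> A \<and> drop j zs \<in> B} = lprob p j A * lprob p (n - j) B"
  using lprob_split_prod[where m = j and n = "n - j"] assms by simp

lemma lprob_split_bound:
  assumes "\<And>x. lprob p n {ys. sum_list ys = x} \<le> b"
  shows "lprob p (m + n) {zs. take m zs \<in> A \<and> sum_list zs = x} \<le> lprob p m A * b"
proof -
  have sum: "sum_list zs = sum_list (take m zs) + sum_list (drop m zs)" for zs :: "int list"
    by (metis append_take_drop_id sum_list_append)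
  have "{zs. take m zs \<in> A \<and> sum_list zs = x} =
     {zs. take m zs \<in> A \<and> drop m zs \<in> UNIV \<and> sum_list (drop m zs) \<in> {x - sum_list (take m zs)}}"
    by (subst sum) (auto simp: algebra_simps)
  then have "lprob p (m + n) {zs. take m zs \<in> A \<and> sum_list zs = x} =
    (\<integral>xs. indicator A xs * lprob p n {ys\<in>UNIV. sum_list ys \<in> {x - sum_list xs}} \<partial>measure_pmf (replicate_pmf m p))"
    by (simp only: lprob_split[where B = UNIV and F = "\<lambda>xs. {x - sum_list xs}"])
  also have "\<dots> \<le> (\<integral>xs. indicator A xs * b \<partial>measure_pmf (replicate_pmf m p))"
  proof (rule integral_mono)
    show "integrable (measure_pmf (replicate_pmf m p))
       (\<lambda>xs. indicator A xs * lprob p n {ys\<in>UNIV. sum_list ys \<in> {x - sum_list xs}})"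
      by (rule measure_pmf.integrable_const_bound[where B = 1]) (auto simp: indicator_def)
    show "indicator A xs * lprob p n {ys\<in>UNIV. sum_list ys \<in> {x - sum_list xs}} \<le> indicator A xs * b" for xs
      using assms[of "x - sum_list xs"] by (intro mult_left_mono) auto
  qed simp
  also have "\<dots> = lprob p m A * b" by simp
  finally show ?thesis .
qed

lemma lprob_take:
  assumes "m \<le> n"
  shows "lprob p n {zs. take m zs \<in> A} = lprob p m A"
  using lprob_split_prod'[OF assms, where B = UNIV] by simp

lemma replicate_pmf_rotate:
  "map_pmf (\<lambda>zs. drop m zs @ take m zs) (replicate_pmf (m + n) p) = replicate_pmf (m + n) p"
proof -
  have "map_pmf (\<lambda>zs. drop m zs @ take m zs) (replicate_pmf (m + n) p) =
     bind_pmf (replicate_pmf m p) (\<lambda>xs. bind_pmf (replicate_pmf n p) (\<lambda>ys. return_pmf (ys @ xs)))"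
    unfolding replicate_pmf_distrib map_bind_pmf map_return_pmf
    by (intro bind_pmf_cong refl) (auto simp: set_replicate_pmf)
  also have "\<dots> = replicate_pmf (n + m) p"
    unfolding replicate_pmf_distrib by (rule bind_commute_pmf)
  finally show ?thesis by (simp add: add.commute)
qed

lemma lprob_rotate:
  assumes "m \<le> n"
  shows "lprob p n {zs. drop m zs @ take m zs \<in> B} = lprob p n B"
proof -
  have "lprob p n B = measure_pmf.prob (map_pmf (\<lambda>zs. drop m zs @ take m zs) (replicate_pmf n p)) B"
    using replicate_pmf_rotate[of m "n - m" p] assms by simp
  then show ?thesis by (simp add: vimage_def)
qed

lemma replicate_pmf_rev: "map_pmf rev (replicate_pmf n p) = replicate_pmf n p"
proof (induction n)
  case (Suc n)
  have "map_pmf rev (replicate_pmf (Suc n) p) =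
     bind_pmf p (\<lambda>x. bind_pmf (map_pmf rev (replicate_pmf n p)) (\<lambda>xs. return_pmf (xs @ [x])))"
    by (simp add: map_bind_pmf map_return_pmf bind_map_pmf)
  also have "\<dots> = bind_pmf (replicate_pmf n p) (\<lambda>xs. bind_pmf p (\<lambda>x. return_pmf (xs @ [x])))"
    unfolding Suc.IH by (rule bind_commute_pmf)
  also have "\<dots> = replicate_pmf (n + 1) p"
    unfolding replicate_pmf_distrib replicate_pmf_1 bind_map_pmf ..
  finally show ?case by simp
qed simp

lemma lprob_rev: "lprob p n {zs. rev zs \<in> B} = lprob p n B"
proof -
  have "lprob p n B = measure_pmf.prob (map_pmf rev (replicate_pmf n p)) B"
    by (simp add: replicate_pmf_rev)
  then show ?thesis by (simp add: vimage_def)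
qed

text \<open>
  Double counting: both the covering bound for unions and the estimates that compare a count of
  levels with a count of rotations are instances.
\<close>

lemma sum_lprob_ge:
  assumes "finite J"
    and "\<And>xs. length xs = n \<Longrightarrow> set xs \<subseteq> set_pmf p \<Longrightarrow> xs \<in> B \<Longrightarrow> m \<le> real (card {j\<in>J. xs \<in> E j})"
  shows "m * lprob p n B \<le> (\<Sum>j\<in>J. lprob p n (E j))"
proof -
  let ?M = "measure_pmf (replicate_pmf n p)"
  have card: "real (card {j\<in>J. xs \<in> E j}) = (\<Sum>j\<in>J. indicator (E j) xs)" for xs
    using assms(1) by (simp add: indicator_def sum.If_cases Int_def)
  have "m * lprob p n B = (\<integral>xs. m * indicator B xs \<partial>?M)" by simp
  also have "\<dots> \<le> (\<integral>xs. (\<Sum>j\<in>J. indicator (E j) xs) \<partial>?M)"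
  proof (rule integral_mono_AE)
    show "AE xs in ?M. m * indicator B xs \<le> (\<Sum>j\<in>J. indicator (E j) xs)"
      unfolding AE_measure_pmf_iff
    proof
      fix xs assume "xs \<in> set_pmf (replicate_pmf n p)"
      then have "length xs = n" "set xs \<subseteq> set_pmf p" by (auto simp: set_replicate_pmf)
      then show "m * indicator B xs \<le> (\<Sum>j\<in>J. indicator (E j) xs)"
        using assms(2)[of xs] card[of xs] by (cases "xs \<in> B") (auto intro: sum_nonneg)
    qed
  qed (auto intro!: Bochner_Integration.integrable_sum integrable_mult_right)
  also have "\<dots> = (\<Sum>j\<in>J. lprob p n (E j))" by simp
  finally show ?thesis .
qed

lemma lprob_le_sum:
  assumes "finite J"
    and "\<And>xs. length xs = n \<Longrightarrow> set xs \<subseteq> set_pmf p \<Longrightarrow> xs \<in> B \<Longrightarrow> \<exists>j\<in>J. xs \<in> E j"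
  shows "lprob p n B \<le> (\<Sum>j\<in>J. lprob p n (E j))"
proof -
  have "1 * lprob p n B \<le> (\<Sum>j\<in>J. lprob p n (E j))"
  proof (rule sum_lprob_ge)
    fix xs assume "length xs = n" "set xs \<subseteq> set_pmf p" "xs \<in> B"
    with assms(2) have "{j\<in>J. xs \<in> E j} \<noteq> {}" by blast
    with assms(1) show "1 \<le> real (card {j\<in>J. xs \<in> E j})"
      using card_gt_0_iff[of "{j\<in>J. xs \<in> E j}"] by simp
  qed fact
  then show ?thesis by simp
qed

lemma sum_lprob_le:
  assumes "finite J"
    and "\<And>xs j. length xs = n \<Longrightarrow> j \<in> J \<Longrightarrow> xs \<in> E j \<Longrightarrow> xs \<in> B"
    and "\<And>xs i j. length xs = n \<Longrightarrow> i \<in> J \<Longrightarrow> j \<in> J \<Longrightarrow> i < j \<Longrightarrow> xs \<in> E i \<Longrightarrow> xs \<in> E j \<Longrightarrow> False"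
  shows "(\<Sum>j\<in>J. lprob p n (E (j::nat))) \<le> lprob p n B"
proof -
  let ?F = "\<lambda>j. {xs\<in>E j. length xs = n}"
  have "(\<Sum>j\<in>J. lprob p n (E j)) = (\<Sum>j\<in>J. lprob p n (?F j))"
    by (intro sum.cong refl lprob_cong) auto
  also have "\<dots> = lprob p n (\<Union>j\<in>J. ?F j)"
  proof (rule measure_pmf.finite_measure_finite_Union[symmetric])
    show "disjoint_family_on ?F J"
      unfolding disjoint_family_on_def
    proof (intro ballI impI)
      fix i j assume "i \<in> J" "j \<in> J" "i \<noteq> j"
      then show "?F i \<inter> ?F j = {}"
        using assms(3)[of _ i j] assms(3)[of _ j i] by (cases "i < j") auto
    qed
  qed (use assms(1) in auto)
  also have "\<dots> \<le> lprob p n B"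
    by (rule measure_pmf.finite_measure_mono) (use assms(2) in auto)
  finally show ?thesis .
qed

section \<open>Decay of the characteristic function of an integer step\<close>

definition cf :: "int pmf \<Rightarrow> real \<Rightarrow> complex" where
  "cf p = char (distr (measure_pmf p) borel real_of_int)"

lemma real_distribution_pmf: "real_distribution (distr (measure_pmf q) borel f)"
  if "f \<in> borel_measurable (measure_pmf q)" for f :: "'a \<Rightarrow> real"
  using that by (intro prob_space.real_distribution_distr measure_pmf.prob_space_axioms)

lemma cf_eq: "cf p t = (\<integral>x. iexp (t * real_of_int x) \<partial>measure_pmf p)"
  unfolding cf_def char_def by (subst integral_distr) auto

lemma integral_bind_pmf_bounded:
  fixes f :: "'b \<Rightarrow> complex"
  assumes "\<And>x. norm (f x) \<le> B"
  shows "(\<integral>y. f y \<partial>measure_pmf (bind_pmf P N)) = (\<integral>x. (\<integral>y. f y \<partial>measure_pmf (N x)) \<partial>measure_pmf P)"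
proof -
  have real: "(\<integral>y. g y \<partial>measure_pmf (bind_pmf P N)) = (\<integral>x. (\<integral>y. g y \<partial>measure_pmf (N x)) \<partial>measure_pmf P)"
    if "\<And>x. \<bar>g x\<bar> \<le> B" for g :: "'b \<Rightarrow> real"
    unfolding measure_pmf_bind
  proof (rule integral_bind[where K = "count_space UNIV" and B = B and B' = 1])
    show "(\<lambda>x. measure_pmf (N x)) \<in> measurable (measure_pmf P) (subprob_algebra (count_space UNIV))"
      by (simp add: measure_subprob)
  qed (use that in \<open>auto simp: measure_pmf.finite_measure_axioms measure_pmf.emeasure_space_1\<close>)
  have int: "integrable (measure_pmf Q) f" for Q :: "'b pmf"
    by (rule measure_pmf.integrable_const_bound[where B = B]) (use assms in auto)
  have norm: "norm (\<integral>y. f y \<partial>measure_pmf Q) \<le> B" for Q :: "'b pmf"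
  proof -
    have "norm (\<integral>y. f y \<partial>measure_pmf Q) \<le> (\<integral>y. norm (f y) \<partial>measure_pmf Q)"
      by (rule integral_norm_bound)
    also have "\<dots> \<le> (\<integral>y. B \<partial>measure_pmf Q)"
      by (intro integral_mono integrable_norm int) (use assms in auto)
    finally show ?thesis by simp
  qed
  have int': "integrable (measure_pmf P) (\<lambda>x. \<integral>y. f y \<partial>measure_pmf (N x))"
    by (rule measure_pmf.integrable_const_bound[where B = B]) (use norm in auto)
  show ?thesis
  proof (rule complex_eqI)
    show "Re (\<integral>y. f y \<partial>measure_pmf (bind_pmf P N)) = Re (\<integral>x. (\<integral>y. f y \<partial>measure_pmf (N x)) \<partial>measure_pmf P)"
      using real[of "\<lambda>x. Re (f x)"] order.trans[OF abs_Re_le_cmod assms]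
      by (simp add: integral_Re[symmetric] int int' del: integral_Re)
    show "Im (\<integral>y. f y \<partial>measure_pmf (bind_pmf P N)) = Im (\<integral>x. (\<integral>y. f y \<partial>measure_pmf (N x)) \<partial>measure_pmf P)"
      using real[of "\<lambda>x. Im (f x)"] order.trans[OF abs_Im_le_cmod assms]
      by (simp add: integral_Im[symmetric] int int' del: integral_Im)
  qed
qed

lemma cf_power:
  "(\<integral>xs. iexp (t * real_of_int (sum_list xs)) \<partial>measure_pmf (replicate_pmf n p)) = cf p t ^ n"
proof (induction n)
  case 0
  then show ?case by simp
next
  case (Suc n)
  have "(\<integral>xs. iexp (t * real_of_int (sum_list xs)) \<partial>measure_pmf (replicate_pmf (Suc n) p)) =
    (\<integral>x. (\<integral>xs. iexp (t * real_of_int (sum_list (x # xs))) \<partial>measure_pmf (replicate_pmf n p)) \<partial>measure_pmf p)"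
    by (simp add: integral_bind_pmf_bounded[where B = 1] map_pmf_def[symmetric] del: sum_list.Cons)
  also have "\<dots> = (\<integral>x. iexp (t * real_of_int x) * cf p t ^ n \<partial>measure_pmf p)"
    by (simp add: Suc.IH[symmetric] ring_distribs exp_add)
  also have "\<dots> = cf p t ^ Suc n"
    by (simp add: cf_eq)
  finally show ?case .
qed

lemma norm_cf_le_1: "norm (cf p t) \<le> 1"
  unfolding cf_def
  by (rule real_distribution.cmod_char_le_1[OF real_distribution_pmf]) simp

lemma cf_measurable [measurable]: "cf p \<in> borel_measurable borel"
  unfolding cf_def
  by (rule real_distribution.char_measurable[OF real_distribution_pmf]) simp

text \<open>
  Jordan's inequality, from the concavity of the sine on the quarter period.
\<close>

lemma sin_ge_linear:
  assumes "0 \<le> s" "s \<le> pi / 2"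
  shows "2 / pi * s \<le> sin s"
proof -
  have "convex_on {0..pi / 2} (\<lambda>x. - sin x)"
  proof (rule f''_ge0_imp_convex)
    fix x :: real assume "x \<in> {0..pi / 2}"
    then show "0 \<le> sin x" by (intro sin_ge_zero) auto
    show "((\<lambda>x. - sin x) has_real_derivative - cos x) (at x)"
      "((\<lambda>x. - cos x) has_real_derivative sin x) (at x)"
      by (auto intro!: derivative_eq_intros)
  qed simp
  from convex_onD[OF this, of "2 / pi * s" 0 "pi / 2"] assms show ?thesis
    by (simp add: field_simps)
qed

lemma sin_squared_add_le: "(sin (x + y :: real))\<^sup>2 \<le> 2 * ((sin x)\<^sup>2 + (sin y)\<^sup>2)"
proof -
  have "\<bar>sin (x + y)\<bar> \<le> \<bar>sin x\<bar> * \<bar>cos y\<bar> + \<bar>cos x\<bar> * \<bar>sin y\<bar>"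
    unfolding sin_add abs_mult[symmetric] by (rule abs_triangle_ineq)
  also have "\<dots> \<le> \<bar>sin x\<bar> * 1 + 1 * \<bar>sin y\<bar>"
    by (intro add_mono mult_mono) auto
  finally have "(sin (x + y))\<^sup>2 \<le> (\<bar>sin x\<bar> + \<bar>sin y\<bar>)\<^sup>2"
    using power_mono[of "\<bar>sin (x + y)\<bar>" "\<bar>sin x\<bar> + \<bar>sin y\<bar>" 2] by simp
  also have "\<dots> \<le> 2 * (\<bar>sin x\<bar>\<^sup>2 + \<bar>sin y\<bar>\<^sup>2)"
    using zero_le_power2[of "\<bar>sin x\<bar> - \<bar>sin y\<bar>"] by (simp add: power2_sum power2_diff)
  finally show ?thesis by simp
qed

text \<open>
  An integer \<open>h\<close> belongs to this set if \<open>cf\<close> stays strictly inside the unit circle away from the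
  multiples of \<open>2 * pi / h\<close>, with a gap that is quadratic near these points. The set is a subgroup
  of the integers that contains all differences of support points, and its positive generator is the
  span of the step distribution. It serves to find the span together with an explicit decay
  estimate, without a compactness argument.
\<close>

definition decay_steps :: "int pmf \<Rightarrow> int set" where
  "decay_steps p = {h. \<exists>c>0. \<forall>t. norm (cf p t) \<le> 1 - c * (sin (t * real_of_int h / 2))\<^sup>2}"

text \<open>
  Two atoms \<open>a\<close> and \<open>b\<close> alone force decay: a unit vector cannot be aligned with both \<open>cis (t * a)\<close>
  and \<open>cis (t * b)\<close> unless \<open>t * (a - b)\<close> is close to a multiple of \<open>2 * pi\<close>.
\<close>

lemma support_difference_in_decay_steps:
  assumes "a \<in> set_pmf p" "b \<in> set_pmf p"
  shows "a - b \<in> decay_steps p"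
proof (cases "a = b")
  case True
  then show ?thesis
    unfolding decay_steps_def using norm_cf_le_1 by (auto intro!: exI[of _ 1])
next
  case False
  define c where "c = min (pmf p a) (pmf p b)"
  have "c > 0" using assms by (simp add: c_def pmf_positive)
  moreover have "norm (cf p t) \<le> 1 - c * (sin (t * real_of_int (a - b) / 2))\<^sup>2" for t
  proof -
    \<comment> \<open>Rotating by the argument makes \<open>cf\<close> real, so that its defect from 1 is the mean of a
       nonnegative function, of which only the two atoms are kept.\<close>
    define \<theta> where "\<theta> = Arg (cf p t)"
    have "norm (cf p t) = Re (cis (-\<theta>) * cf p t)"
      using arg_cong[OF rcis_cmod_Arg[of "cf p t"], of "\<lambda>z. Re (cis (-\<theta>) * z)"]
      by (simp add: \<theta>_def rcis_def mult.left_commute[of "cis _"] cis_mult)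
    also have "cis (-\<theta>) * cf p t = (\<integral>x. cis (t * real_of_int x - \<theta>) \<partial>measure_pmf p)"
    proof -
      have "cis (-\<theta>) * iexp (t * real_of_int x) = cis (t * real_of_int x - \<theta>)" for x
        unfolding cis_conv_exp[symmetric] cis_mult by simp
      then show ?thesis
        unfolding cf_eq by (subst integral_mult_right_zero[symmetric]) simp
    qed
    also have "Re \<dots> = (\<integral>x. cos (t * real_of_int x - \<theta>) \<partial>measure_pmf p)"
      by (subst integral_Re[symmetric]) (auto intro!: measure_pmf.integrable_const_bound[where B = 1])
    finally have "1 - norm (cf p t) = (\<integral>x. 1 - cos (t * real_of_int x - \<theta>) \<partial>measure_pmf p)"
      by (subst Bochner_Integration.integral_diff)
         (auto intro!: measure_pmf.integrable_const_bound[where B = 1])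
    also have "\<dots> \<ge> (\<integral>x. indicator {a, b} x * (1 - cos (t * real_of_int x - \<theta>)) \<partial>measure_pmf p)"
    proof (intro integral_mono measure_pmf.integrable_const_bound[where B = 2] AE_I2)
      have "\<bar>1 - cos z\<bar> \<le> 2" for z :: real
        using cos_ge_minus_one[of z] cos_le_one[of z] by linarith
      then show "norm (indicator {a, b} x * (1 - cos (t * real_of_int x - \<theta>))) \<le> 2"
        "norm (1 - cos (t * real_of_int x - \<theta>)) \<le> 2" for x
        by (auto simp: indicator_def)
    qed (auto simp: indicator_def)
    moreover have "(\<integral>x. indicator {a, b} x * (1 - cos (t * real_of_int x - \<theta>)) \<partial>measure_pmf p) =
      pmf p a * (1 - cos (t * real_of_int a - \<theta>)) + pmf p b * (1 - cos (t * real_of_int b - \<theta>))"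
      by (subst integral_measure_pmf_real[where A = "{a, b}"]) (use False in \<open>auto simp: indicator_def split: if_splits\<close>)
    moreover have "1 - cos x = 2 * (sin (x / 2))\<^sup>2" for x :: real
      using cos_double_sin[of "x / 2"] by simp
    moreover have "c * (sin (t * real_of_int (a - b) / 2))\<^sup>2 \<le>
       2 * c * ((sin ((t * real_of_int a - \<theta>) / 2))\<^sup>2 + (sin ((t * real_of_int b - \<theta>) / 2))\<^sup>2)"
    proof -
      have "t * real_of_int (a - b) / 2 = (t * real_of_int a - \<theta>) / 2 + - ((t * real_of_int b - \<theta>) / 2)"
        by (simp add: field_simps)
      then show ?thesis
        using mult_left_mono[OF sin_squared_add_le[of "(t * real_of_int a - \<theta>) / 2" "- ((t * real_of_int b - \<theta>) / 2)"], of c] \<open>c > 0\<close>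
        by (simp only: sin_minus power2_minus) simp
    qed
    moreover have "c * (sin ((t * real_of_int a - \<theta>) / 2))\<^sup>2 \<le> pmf p a * (sin ((t * real_of_int a - \<theta>) / 2))\<^sup>2"
      "c * (sin ((t * real_of_int b - \<theta>) / 2))\<^sup>2 \<le> pmf p b * (sin ((t * real_of_int b - \<theta>) / 2))\<^sup>2"
      by (intro mult_right_mono; simp add: c_def)+
    ultimately show ?thesis
      by (simp add: algebra_simps)
  qed
  ultimately show ?thesis unfolding decay_steps_def by blast
qed

lemma decay_steps_add:
  assumes "g \<in> decay_steps p" "h \<in> decay_steps p"
  shows "g + h \<in> decay_steps p"
proof -
  from assms obtain c d where "c > 0" "d > 0"
    and c: "\<And>t. norm (cf p t) \<le> 1 - c * (sin (t * real_of_int g / 2))\<^sup>2"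
    and d: "\<And>t. norm (cf p t) \<le> 1 - d * (sin (t * real_of_int h / 2))\<^sup>2"
    unfolding decay_steps_def by blast
  define e where "e = min c d / 4"
  have "norm (cf p t) \<le> 1 - e * (sin (t * real_of_int (g + h) / 2))\<^sup>2" for t
  proof -
    have "e * (sin (t * real_of_int (g + h) / 2))\<^sup>2 \<le>
        e * (2 * ((sin (t * real_of_int g / 2))\<^sup>2 + (sin (t * real_of_int h / 2))\<^sup>2))"
      using sin_squared_add_le[of "t * real_of_int g / 2" "t * real_of_int h / 2"] \<open>c > 0\<close> \<open>d > 0\<close>
      by (intro mult_left_mono) (auto simp: e_def algebra_simps add_divide_distrib)
    moreover have "2 * e * (sin (t * real_of_int g / 2))\<^sup>2 \<le> c / 2 * (sin (t * real_of_int g / 2))\<^sup>2"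
      "2 * e * (sin (t * real_of_int h / 2))\<^sup>2 \<le> d / 2 * (sin (t * real_of_int h / 2))\<^sup>2"
      by (intro mult_right_mono; simp add: e_def)+
    ultimately show ?thesis
      using c[of t] d[of t] by (simp add: algebra_simps)
  qed
  moreover have "e > 0" using \<open>c > 0\<close> \<open>d > 0\<close> by (simp add: e_def)
  ultimately show ?thesis unfolding decay_steps_def by blast
qed

lemma decay_steps_uminus:
  assumes "h \<in> decay_steps p"
  shows "- h \<in> decay_steps p"
  using assms unfolding decay_steps_def by simp

lemma decay_steps_mult:
  assumes "h \<in> decay_steps p"
  shows "k * h \<in> decay_steps p"
proof -
  have nat: "int n * h \<in> decay_steps p" for n
  proof (induction n)
    case 0
    show ?case unfolding decay_steps_def using norm_cf_le_1 by (auto intro!: exI[of _ 1])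
  next
    case (Suc n)
    then show ?case using decay_steps_add[OF assms, of "int n * h"] by (simp add: ring_distribs)
  qed
  show ?thesis
    using nat[of "nat k"] decay_steps_uminus[OF nat[of "nat (- k)"]] by (cases "k \<ge> 0") auto
qed

text \<open>
  The least positive element \<open>d\<close> of \<open>decay_steps p\<close> divides all its elements, in particular all
  differences of support points. On the dual period, where \<open>t * d / 2\<close> stays within a quarter
  period of the sine, the decay along \<open>d\<close> is quadratic in \<open>t\<close>.
\<close>

lemma norm_cf_le_gaussian:
  assumes "x \<in> set_pmf p" "y \<in> set_pmf p" "x \<noteq> y"
  obtains d :: nat and c :: real where "d > 0" "c > 0"
    "\<And>a b. a \<in> set_pmf p \<Longrightarrow> b \<in> set_pmf p \<Longrightarrow> int d dvd a - b"
    "\<And>t. \<bar>t\<bar> \<le> pi / real d \<Longrightarrow> norm (cf p t) \<le> exp (- c * t\<^sup>2)"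
proof -
  have "\<exists>d>0. int d \<in> decay_steps p"
  proof (rule exI[of _ "nat \<bar>x - y\<bar>"])
    show "0 < nat \<bar>x - y\<bar> \<and> int (nat \<bar>x - y\<bar>) \<in> decay_steps p"
      using assms support_difference_in_decay_steps[of x p y] support_difference_in_decay_steps[of y p x]
      by (auto simp: abs_if)
  qed
  then obtain d where d: "d > 0" "int d \<in> decay_steps p"
      and least: "\<And>e. e > 0 \<Longrightarrow> int e \<in> decay_steps p \<Longrightarrow> d \<le> e"
    using exists_least_iff[of "\<lambda>d. d > 0 \<and> int d \<in> decay_steps p"] by (meson not_le_imp_less)
  have dvd: "int d dvd h" if "h \<in> decay_steps p" for h
  proof (rule ccontr)
    assume "\<not> int d dvd h"
    then have "h mod int d > 0" "h mod int d < int d"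
      using d(1) pos_mod_sign[of "int d" h] pos_mod_bound[of "int d" h]
      unfolding dvd_eq_mod_eq_0 by linarith+
    moreover have "h mod int d \<in> decay_steps p"
      using decay_steps_add[OF that decay_steps_uminus[OF decay_steps_mult[OF d(2), of "h div int d"]]]
      by (simp add: minus_div_mult_eq_mod)
    ultimately show False using least[of "nat (h mod int d)"] by simp
  qed
  from d(2) obtain c0 where c0: "c0 > 0" "\<And>t. norm (cf p t) \<le> 1 - c0 * (sin (t * real d / 2))\<^sup>2"
    unfolding decay_steps_def by auto
  define c where "c = c0 * (real d / pi)\<^sup>2"
  have "norm (cf p t) \<le> exp (- c * t\<^sup>2)" if "\<bar>t\<bar> \<le> pi / real d" for t
  proof -
    let ?s = "\<bar>t\<bar> * real d / 2"
    have s: "0 \<le> ?s" "?s \<le> pi / 2"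
      using that d(1) by (auto simp: field_simps)
    have "2 / pi * ?s \<le> sin ?s"
      using s by (rule sin_ge_linear)
    then have "(\<bar>t\<bar> * (real d / pi))\<^sup>2 \<le> (sin ?s)\<^sup>2"
      by (intro power_mono) (auto simp: field_simps)
    also have "(sin ?s)\<^sup>2 = (sin (t * real d / 2))\<^sup>2"
      by (auto simp: abs_if)
    finally have "c * t\<^sup>2 \<le> c0 * (sin (t * real d / 2))\<^sup>2"
      using c0(1) mult_left_mono[of "(\<bar>t\<bar> * (real d / pi))\<^sup>2" "(sin (t * real d / 2))\<^sup>2" c0]
      by (simp add: c_def power_mult_distrib power_divide mult_ac)
    then have "norm (cf p t) \<le> 1 + (- c * t\<^sup>2)" using c0(2)[of t] by simp
    also have "\<dots> \<le> exp (- c * t\<^sup>2)" by (rule exp_ge_add_one_self)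
    finally show ?thesis .
  qed
  moreover have "c > 0" using c0(1) d(1) by (simp add: c_def)
  ultimately show ?thesis
    using that[of d c] d(1) dvd support_difference_in_decay_steps by blast
qed


lemma has_integral_gaussian:
  assumes "(c::real) > 0"
  shows "has_bochner_integral lborel (\<lambda>t. exp (- c * t\<^sup>2)) (sqrt (pi / c))"
proof -
  have "has_bochner_integral lborel (\<lambda>t::real. exp (- t\<^sup>2)) (sqrt pi / 2 + sqrt pi / 2)"
    using has_bochner_integral_even_function[OF gaussian_moment_0] by simp
  then have "has_bochner_integral lborel (\<lambda>t::real. exp (- (0 + sqrt c * t)\<^sup>2)) (sqrt pi /\<^sub>R \<bar>sqrt c\<bar>)"
    using lborel_has_bochner_integral_real_affine_iff[of "sqrt c" "\<lambda>t. exp (- t\<^sup>2)" "sqrt pi" 0] assms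
    by simp
  then show ?thesis
    using assms by (simp add: power_mult_distrib real_sqrt_mult real_sqrt_inverse divide_inverse mult.commute)
qed

lemma integral_cos_lattice:
  assumes "d > 0" "int d dvd k"
  shows "(\<integral>t. indicator {-(pi / real d)..pi / real d} t * cos (t * real_of_int k) \<partial>lborel)
    = (if k = 0 then 2 * pi / real d else 0)"
proof (cases "k = 0")
  case True
  then show ?thesis using assms(1) by simp
next
  case False
  obtain m where m: "k = int d * m" using assms(2) by auto
  have "(\<integral>t. indicator {-(pi / real d)..pi / real d} t *\<^sub>R cos (t * real_of_int k) \<partial>lborel)
     = sin (pi / real d * real_of_int k) / real_of_int k - sin (-(pi / real d) * real_of_int k) / real_of_int k"
  proof (rule integral_FTC_atLeastAtMost)
    have "-(pi / real d) \<le> 0" "0 \<le> pi / real d" using assms(1) by simp_all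
    then show "-(pi / real d) \<le> pi / real d" by linarith
    fix x
    show "((\<lambda>t. sin (t * real_of_int k) / real_of_int k) has_vector_derivative cos (x * real_of_int k))
       (at x within {- (pi / real d)..pi / real d})"
      unfolding has_real_derivative_iff_has_vector_derivative[symmetric]
      by (rule derivative_eq_intros refl | use False in simp)+
  qed (intro continuous_intros)
  also have "pi / real d * real_of_int k = real_of_int m * pi"
    using assms(1) by (simp add: m)
  also have "-(pi / real d) * real_of_int k = - (real_of_int m * pi)"
    using assms(1) by (simp add: m)
  finally show ?thesis using False by (simp add: sin_zero_iff_int2)
qed

text \<open>
  Fourier inversion over the dual period of the lattice \<open>d\<close>. If \<open>d\<close> is the span, integrating over
  this shorter period instead of over \<open>{-pi..pi}\<close> leaves \<open>t = 0\<close> as the only point at which the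
  modulus of \<open>cf\<close> reaches 1.
\<close>

lemma lprob_fourier:
  assumes d: "d > 0"
    and lattice: "\<And>xs. length xs = n \<Longrightarrow> set xs \<subseteq> set_pmf p \<Longrightarrow> int d dvd sum_list xs - x"
  shows "lprob p n {xs. sum_list xs = x} = real d / (2 * pi) *
    (\<integral>t. indicator {-(pi / real d)..pi / real d} t * Re (cis (-(t * real_of_int x)) * cf p t ^ n) \<partial>lborel)"
proof -
  let ?Q = "measure_pmf (replicate_pmf n p)"
  let ?I = "{-(pi / real d)..pi / real d}"
  define W where "W = distr ?Q borel (\<lambda>xs. real_of_int (sum_list xs - x))"
  interpret W: real_distribution W
    unfolding W_def by (rule real_distribution_pmf) simp
  interpret pair_sigma_finite W lborel
    by standard
  have cos: "Re (cis (-(t * real_of_int x)) * cf p t ^ n) = (\<integral>y. cos (t * y) \<partial>W)" for t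
  proof -
    have "cis (-(t * real_of_int x)) * cf p t ^ n
      = (\<integral>xs. cis (-(t * real_of_int x)) * iexp (t * real_of_int (sum_list xs)) \<partial>?Q)"
      by (simp only: cf_power[symmetric] integral_mult_right_zero)
    also have "\<dots> = (\<integral>xs. cis (t * real_of_int (sum_list xs - x)) \<partial>?Q)"
      unfolding cis_conv_exp[symmetric] cis_mult by (simp add: algebra_simps)
    also have "Re \<dots> = (\<integral>xs. cos (t * real_of_int (sum_list xs - x)) \<partial>?Q)"
      by (subst integral_Re[symmetric]) (auto intro!: measure_pmf.integrable_const_bound[where B = 1])
    also have "\<dots> = (\<integral>y. cos (t * y) \<partial>W)"
      unfolding W_def by (subst integral_distr) auto
    finally show ?thesis .
  qed
  have "integrable (W \<Otimes>\<^sub>M lborel) (\<lambda>(y, t). indicator ?I t * cos (t * y))"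
  proof (rule integrableI_bounded_set[where A = "UNIV \<times> ?I" and B = 1])
    have "emeasure (W \<Otimes>\<^sub>M lborel) (UNIV \<times> ?I) = emeasure W UNIV * emeasure lborel ?I"
      by (rule lborel.emeasure_pair_measure_Times) auto
    also have "\<dots> < \<infinity>"
      using W.emeasure_space_1 by (simp add: W.emeasure_eq_measure ennreal_mult_less_top emeasure_lborel_Icc_eq)
    finally show "emeasure (W \<Otimes>\<^sub>M lborel) (UNIV \<times> ?I) < \<infinity>" .
  qed (auto simp: W.events_eq_borel indicator_def split: if_splits)
  from Fubini_integral[OF this]
  have "(\<integral>t. indicator ?I t * Re (cis (-(t * real_of_int x)) * cf p t ^ n) \<partial>lborel)
     = (\<integral>y. (\<integral>t. indicator ?I t * cos (t * y) \<partial>lborel) \<partial>W)"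
    by (simp only: cos integral_mult_right_zero)
  also have "\<dots> = (\<integral>xs. (\<integral>t. indicator ?I t * cos (t * real_of_int (sum_list xs - x)) \<partial>lborel) \<partial>?Q)"
    unfolding W_def by (rule integral_distr) (auto simp: lborel.borel_measurable_lebesgue_integral)
  also have "\<dots> = (\<integral>xs. indicator {xs. sum_list xs = x} xs * (2 * pi / real d) \<partial>?Q)"
  proof (rule integral_cong_AE)
    show "AE xs in ?Q. (\<integral>t. indicator ?I t * cos (t * real_of_int (sum_list xs - x)) \<partial>lborel)
       = indicator {xs. sum_list xs = x} xs * (2 * pi / real d)"
      unfolding AE_measure_pmf_iff
    proof
      fix xs assume "xs \<in> set_pmf (replicate_pmf n p)"
      then have "int d dvd sum_list xs - x"
        by (intro lattice) (auto simp: set_replicate_pmf)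
      from integral_cos_lattice[OF d this]
      show "(\<integral>t. indicator ?I t * cos (t * real_of_int (sum_list xs - x)) \<partial>lborel)
       = indicator {xs. sum_list xs = x} xs * (2 * pi / real d)"
        by (simp add: indicator_def)
    qed
  qed auto
  also have "\<dots> = lprob p n {xs. sum_list xs = x} * (2 * pi / real d)" by simp
  finally show ?thesis using d by simp
qed

text \<open>
  The convergence behind the central limit theorem, kept at the level of characteristic functions
  because the local limit theorem integrates them.
\<close>

lemma (in real_distribution) char_power_tendsto_gaussian:
  assumes int1: "integrable M (\<lambda>x. x)" and mean: "expectation (\<lambda>x. x) = 0"
    and int2: "integrable M (\<lambda>x. x\<^sup>2)" and var: "expectation (\<lambda>x. x\<^sup>2) = v"
  shows "(\<lambda>n. char M (t / sqrt (real n)) ^ n) \<longlonglongrightarrow> complex_of_real (exp (- (v * t\<^sup>2 / 2)))"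
proof -
  let ?t = "\<lambda>n. t / sqrt (real n)"
  let ?R = "\<lambda>n. t\<^sup>2 / 6 * (\<integral>x. min (6 * x\<^sup>2) (\<bar>?t n\<bar> * \<bar>x\<bar> ^ 3) \<partial>M)"
  have v: "v \<ge> 0" unfolding var[symmetric] by simp
  have "eventually (\<lambda>n. cmod (char M (?t n) ^ n - complex_of_real ((1 + (- (v * t\<^sup>2 / 2)) / real n) ^ n)) \<le> ?R n) sequentially"
  proof (rule eventually_sequentiallyI)
    fix n :: nat assume "n \<ge> nat \<lceil>v * t\<^sup>2 / 4\<rceil> + 1"
    then have n: "v * t\<^sup>2 / 4 \<le> real n" "n > 0" by linarith+
    have "cmod (char M (?t n) - (1 - (?t n)\<^sup>2 * v / 2))
       \<le> (?t n)\<^sup>2 / 6 * (\<integral>x. min (6 * x\<^sup>2) (\<bar>?t n\<bar> * \<bar>x\<bar> ^ 3) \<partial>M)"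
      by (rule char_approx3) (use assms in simp_all)
    also have "(?t n)\<^sup>2 = t\<^sup>2 / real n" by (simp add: power_divide)
    finally have 1: "cmod (char M (?t n) - complex_of_real (1 + (- (v * t\<^sup>2 / 2)) / real n))
        \<le> t\<^sup>2 / real n / 6 * (\<integral>x. min (6 * x\<^sup>2) (\<bar>?t n\<bar> * \<bar>x\<bar> ^ 3) \<partial>M)"
      by (simp add: mult.commute)
    have "cmod (char M (?t n) ^ n - complex_of_real (1 + (- (v * t\<^sup>2 / 2)) / real n) ^ n)
       \<le> real n * cmod (char M (?t n) - complex_of_real (1 + (- (v * t\<^sup>2 / 2)) / real n))"
    proof (rule norm_power_diff)
      have "0 \<le> v * t\<^sup>2 / 2 / real n" "v * t\<^sup>2 / 2 / real n \<le> 2"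
        using n v by (auto simp: field_simps)
      then show "cmod (complex_of_real (1 + (- (v * t\<^sup>2 / 2)) / real n)) \<le> 1"
        unfolding norm_of_real by (simp add: abs_le_iff)
    qed (rule cmod_char_le_1)
    also have "\<dots> \<le> real n * (t\<^sup>2 / real n / 6 * (\<integral>x. min (6 * x\<^sup>2) (\<bar>?t n\<bar> * \<bar>x\<bar> ^ 3) \<partial>M))"
      by (rule mult_left_mono[OF 1]) simp
    also have "\<dots> = ?R n" using n(2) by simp
    finally show "cmod (char M (?t n) ^ n - complex_of_real ((1 + (- (v * t\<^sup>2 / 2)) / real n) ^ n)) \<le> ?R n"
      by simp
  qed
  moreover have "?R \<longlonglongrightarrow> 0"
  proof -
    have "(\<lambda>n. min (6 * x\<^sup>2) (\<bar>?t n\<bar> * \<bar>x\<bar> ^ 3)) \<longlonglongrightarrow> 0" for x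
    proof (rule tendsto_eq_rhs)
      have "?t \<longlonglongrightarrow> 0" by real_asymp
      then show "(\<lambda>n. min (6 * x\<^sup>2) (\<bar>?t n\<bar> * \<bar>x\<bar> ^ 3)) \<longlonglongrightarrow> min (6 * x\<^sup>2) (\<bar>0\<bar> * \<bar>x\<bar> ^ 3)"
        by (intro tendsto_intros)
    qed simp
    then have "(\<lambda>n. \<integral>x. min (6 * x\<^sup>2) (\<bar>?t n\<bar> * \<bar>x\<bar> ^ 3) \<partial>M) \<longlonglongrightarrow> (\<integral>x. 0 \<partial>M)"
      by (intro integral_dominated_convergence [where w = "\<lambda>x. 6 * x\<^sup>2"]) (use int2 in auto)
    from tendsto_mult_left[OF this, of "t\<^sup>2 / 6"] show ?thesis by simp
  qed
  ultimately have lim: "(\<lambda>n. char M (?t n) ^ n - complex_of_real ((1 + (- (v * t\<^sup>2 / 2)) / real n) ^ n)) \<longlonglongrightarrow> 0"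
    by (rule Lim_null_comparison)
  from tendsto_add[OF lim, of "\<lambda>n. complex_of_real ((1 + (- (v * t\<^sup>2 / 2)) / real n) ^ n)"]
  show ?thesis
    using tendsto_of_real[OF tendsto_exp_limit_sequentially[of "- (v * t\<^sup>2 / 2)"], where ?'a = complex]
    by simp
qed

section \<open>Local limit estimates\<close>

text \<open>
  Degenerate steps are excluded because their return probabilities do not decay.
\<close>

locale centered_step =
  fixes p :: "int pmf"
  assumes integrable_step: "integrable (measure_pmf p) real_of_int"
    and mean_step: "(\<integral>x. real_of_int x \<partial>measure_pmf p) = 0"
    and square_integrable_step: "integrable (measure_pmf p) (\<lambda>x. (real_of_int x)\<^sup>2)"
    and nontrivial_step: "set_pmf p \<noteq> {0}"
begin

lemma two_steps: "\<exists>x y. x \<in> set_pmf p \<and> y \<in> set_pmf p \<and> x \<noteq> y"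
proof (rule ccontr)
  assume *: "\<not> ?thesis"
  obtain x where x: "x \<in> set_pmf p" using set_pmf_not_empty by fast
  with * have eq: "set_pmf p = {x}" by auto
  then have "p = return_pmf x" by (simp add: set_pmf_subset_singleton[symmetric])
  then have "(\<integral>x. real_of_int x \<partial>measure_pmf p) = real_of_int x" by simp
  with mean_step eq nontrivial_step show False by simp
qed

lemma variance_pos: "(\<integral>x. (real_of_int x)\<^sup>2 \<partial>measure_pmf p) > 0"
proof (rule ccontr)
  assume "\<not> ?thesis"
  moreover have "(\<integral>x. (real_of_int x)\<^sup>2 \<partial>measure_pmf p) \<ge> 0" by simp
  ultimately have "(\<integral>x. (real_of_int x)\<^sup>2 \<partial>measure_pmf p) = 0" by linarith
  then have "AE x in measure_pmf p. (real_of_int x)\<^sup>2 = 0"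
    using integral_nonneg_eq_0_iff_AE[OF square_integrable_step] by simp
  then have "\<And>x. x \<in> set_pmf p \<Longrightarrow> x = 0" by (simp add: AE_measure_pmf_iff)
  with two_steps show False by blast
qed

lemma cf_power_tendsto:
  "(\<lambda>n. Re (cf p (t / sqrt (real n)) ^ n)) \<longlonglongrightarrow>
     exp (- ((\<integral>x. (real_of_int x)\<^sup>2 \<partial>measure_pmf p) / 2) * t\<^sup>2)"
proof -
  interpret real_distribution "distr (measure_pmf p) borel real_of_int"
    by (rule real_distribution_pmf) simp
  have "(\<lambda>n. cf p (t / sqrt (real n)) ^ n) \<longlonglongrightarrow>
      complex_of_real (exp (- ((\<integral>x. (real_of_int x)\<^sup>2 \<partial>measure_pmf p) * t\<^sup>2 / 2)))"
    unfolding cf_def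
    by (rule char_power_tendsto_gaussian)
       (use integrable_step mean_step square_integrable_step in
         \<open>simp_all add: integrable_distr_eq integral_distr\<close>)
  from tendsto_Re[OF this] show ?thesis by simp
qed

text \<open>
  The integer \<open>a\<close> is any point of the support: sums of \<open>n\<close> steps lie in \<open>n * a\<close> plus the multiples
  of the span \<open>d\<close>, so a return at time \<open>n\<close> requires \<open>d\<close> to divide \<open>n * a\<close>. For large \<open>n\<close> this
  condition is also sufficient. It is stated in this form because it is inherited by
  differences of times.
\<close>

theorem local_limit_estimates:
  obtains d :: nat and a :: int and C c :: real and N :: nat where
    "d > 0" "C > 0" "c > 0"
    "\<And>n x. n \<ge> 1 \<Longrightarrow> lprob p n {xs. sum_list xs = x} \<le> C / sqrt (real n)"
    "\<And>n. lprob p n {xs. sum_list xs = 0} > 0 \<Longrightarrow> int d dvd int n * a"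
    "\<And>n. n \<ge> N \<Longrightarrow> int d dvd int n * a \<Longrightarrow> c / sqrt (real n) \<le> lprob p n {xs. sum_list xs = 0}"
proof -
  obtain x0 y0 where xy: "x0 \<in> set_pmf p" "y0 \<in> set_pmf p" "x0 \<noteq> y0" using two_steps by blast
  obtain d :: nat and b :: real where d: "d > 0" and b: "b > 0"
    and dvd: "\<And>a b. a \<in> set_pmf p \<Longrightarrow> b \<in> set_pmf p \<Longrightarrow> int d dvd a - b"
    and gauss: "\<And>t. \<bar>t\<bar> \<le> pi / real d \<Longrightarrow> norm (cf p t) \<le> exp (- b * t\<^sup>2)"
    using norm_cf_le_gaussian[OF xy] by blast
  let ?I = "{-(pi / real d)..pi / real d}"
  have lattice: "int d dvd sum_list xs - int n * x0"
    if "length xs = n" "set xs \<subseteq> set_pmf p" for xs n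
    using that
  proof (induction xs arbitrary: n)
    case (Cons y ys)
    have "sum_list (y # ys) - int n * x0 = (y - x0) + (sum_list ys - int (length ys) * x0)"
      using Cons.prems by (auto simp: algebra_simps)
    with Cons dvd[of y x0] xy(1) show ?case by (metis dvd_add insert_subset list.simps(15))
  qed auto
  have in_lattice: "int d dvd x - int n * x0" if pos: "lprob p n {xs. sum_list xs = x} > 0" for n x
  proof -
    have "\<exists>xs. length xs = n \<and> set xs \<subseteq> set_pmf p \<and> sum_list xs = x"
      using lprob_mono[of n p "{xs. sum_list xs = x}" "{}"] pos by force
    with lattice show ?thesis by blast
  qed
  have fourier: "lprob p n {xs. sum_list xs = x} = real d / (2 * pi) *
    (\<integral>t. indicator ?I t * Re (cis (-(t * real_of_int x)) * cf p t ^ n) \<partial>lborel)"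
    if "int d dvd x - int n * x0" for n x
  proof (rule lprob_fourier[OF d])
    fix xs :: "int list" assume "length xs = n" "set xs \<subseteq> set_pmf p"
    from lattice[OF this] that have "int d dvd (sum_list xs - int n * x0) - (x - int n * x0)"
      by (rule dvd_diff)
    then show "int d dvd sum_list xs - x" by simp
  qed
  have power: "norm (cf p t) ^ n \<le> exp (- (b * real n) * t\<^sup>2)" if "t \<in> ?I" for n t
  proof -
    have "norm (cf p t) ^ n \<le> exp (- b * t\<^sup>2) ^ n"
      using that by (intro power_mono gauss) auto
    then show ?thesis by (simp add: exp_of_nat_mult[symmetric] mult_ac)
  qed
  define C where "C = real d / (2 * pi) * sqrt (pi / b)"
  have upper: "lprob p n {xs. sum_list xs = x} \<le> C / sqrt (real n)" if n: "n \<ge> 1" for n x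
  proof (cases "lprob p n {xs. sum_list xs = x} > 0")
    case True
    have G: "has_bochner_integral lborel (\<lambda>t. exp (- (b * real n) * t\<^sup>2)) (sqrt (pi / (b * real n)))"
      using b n by (intro has_integral_gaussian) simp
    have "(\<integral>t. indicator ?I t * Re (cis (-(t * real_of_int x)) * cf p t ^ n) \<partial>lborel)
       \<le> (\<integral>t. exp (- (b * real n) * t\<^sup>2) \<partial>lborel)"
    proof (rule integral_mono_AE')
      show "integrable lborel (\<lambda>t. exp (- (b * real n) * t\<^sup>2))"
        using G by (rule integrable.intros)
      have "indicator ?I t * Re (cis (-(t * real_of_int x)) * cf p t ^ n) \<le> exp (- (b * real n) * t\<^sup>2)" for t
      proof (cases "t \<in> ?I")
        case True
        have "Re (cis (-(t * real_of_int x)) * cf p t ^ n) \<le> norm (cis (-(t * real_of_int x)) * cf p t ^ n)"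
          by (rule complex_Re_le_cmod)
        with power[OF True, of n] True show ?thesis by (simp add: norm_mult norm_power)
      qed simp
      then show "AE t in lborel. indicator ?I t * Re (cis (-(t * real_of_int x)) * cf p t ^ n) \<le> exp (- (b * real n) * t\<^sup>2)"
        by simp
    qed simp
    also have "\<dots> = sqrt (pi / b) / sqrt (real n)"
      using G by (simp add: has_bochner_integral_integral_eq real_sqrt_divide real_sqrt_mult)
    finally have "real d / (2 * pi) * (\<integral>t. indicator ?I t * Re (cis (-(t * real_of_int x)) * cf p t ^ n) \<partial>lborel)
       \<le> real d / (2 * pi) * (sqrt (pi / b) / sqrt (real n))"
      by (rule mult_left_mono) simp
    then show ?thesis using fourier[OF in_lattice[OF True]] by (simp add: C_def)
  next
    case False
    have "0 \<le> C / sqrt (real n)" using b by (simp add: C_def)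
    with False show ?thesis by linarith
  qed
  define v where "v = (\<integral>x. (real_of_int x)\<^sup>2 \<partial>measure_pmf p)"
  have v: "v > 0" unfolding v_def by (rule variance_pos)
  define J where "J n = (\<integral>s. indicator ?I (s / sqrt (real n)) * Re (cf p (s / sqrt (real n)) ^ n) \<partial>lborel)" for n
  \<comment> \<open>The shift avoids \<open>n = 0\<close>, where the integrand is 1 and no Gaussian dominates it.\<close>
  have "(\<lambda>n. J (Suc n)) \<longlonglongrightarrow> (\<integral>s. exp (- (v / 2) * s\<^sup>2) \<partial>lborel)"
    unfolding J_def
  proof (rule integral_dominated_convergence[where w = "\<lambda>s. exp (- b * s\<^sup>2)"])
    show "integrable lborel (\<lambda>s. exp (- b * s\<^sup>2))"
      using has_integral_gaussian[OF b] by (rule integrable.intros)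
    show "AE s in lborel. (\<lambda>n. indicator ?I (s / sqrt (real (Suc n))) * Re (cf p (s / sqrt (real (Suc n))) ^ Suc n))
        \<longlonglongrightarrow> exp (- (v / 2) * s\<^sup>2)"
    proof (rule AE_I2)
      fix s :: real
      have "(\<lambda>n. s / sqrt (real n)) \<longlonglongrightarrow> 0" by real_asymp
      moreover have "0 < pi / real d" using d by simp
      ultimately have "eventually (\<lambda>n. \<bar>s / sqrt (real n)\<bar> < pi / real d) sequentially"
        by (simp add: tendsto_iff dist_real_def)
      then have "eventually (\<lambda>n. Re (cf p (s / sqrt (real n)) ^ n) =
           indicator ?I (s / sqrt (real n)) * Re (cf p (s / sqrt (real n)) ^ n)) sequentially"
      proof eventually_elim
        case (elim n)
        then have "s / sqrt (real n) \<in> ?I" by (simp only: abs_less_iff atLeastAtMost_iff) linarith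
        then show ?case by simp
      qed
      from Lim_transform_eventually[OF cf_power_tendsto this]
      have "(\<lambda>n. indicator ?I (s / sqrt (real n)) * Re (cf p (s / sqrt (real n)) ^ n)) \<longlonglongrightarrow> exp (- (v / 2) * s\<^sup>2)"
        unfolding v_def .
      then show "(\<lambda>n. indicator ?I (s / sqrt (real (Suc n))) * Re (cf p (s / sqrt (real (Suc n))) ^ Suc n))
        \<longlonglongrightarrow> exp (- (v / 2) * s\<^sup>2)"
        by (rule LIMSEQ_Suc)
    qed
    show "AE s in lborel. norm (indicator ?I (s / sqrt (real (Suc n))) * Re (cf p (s / sqrt (real (Suc n))) ^ Suc n))
        \<le> exp (- b * s\<^sup>2)" for n
    proof (rule AE_I2)
      fix s :: real
      let ?t = "s / sqrt (real (Suc n))"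
      show "norm (indicator ?I ?t * Re (cf p ?t ^ Suc n)) \<le> exp (- b * s\<^sup>2)"
      proof (cases "?t \<in> ?I")
        case True
        have "norm (Re (cf p ?t ^ Suc n)) \<le> norm (cf p ?t) ^ Suc n"
          using abs_Re_le_cmod[of "cf p ?t ^ Suc n"] by (simp only: norm_power real_norm_def)
        also have "\<dots> \<le> exp (- (b * real (Suc n)) * ?t\<^sup>2)" by (rule power[OF True])
        also have "- (b * real (Suc n)) * ?t\<^sup>2 = - b * s\<^sup>2"
          by (simp add: power_divide del: of_nat_Suc)
        finally show ?thesis using True by simp
      qed simp
    qed
  qed measurable
  then have J: "J \<longlonglongrightarrow> sqrt (pi / (v / 2))"
    using has_bochner_integral_integral_eq[OF has_integral_gaussian[of "v / 2"]] v
    by (simp add: LIMSEQ_imp_Suc)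
  define g where "g = sqrt (pi / (v / 2)) / 2"
  have g: "g > 0" using v by (simp add: g_def)
  have "eventually (\<lambda>n. J n > g) sequentially"
    by (rule order_tendstoD(1)[OF J]) (use g in \<open>simp add: g_def\<close>)
  then obtain N where N: "\<And>n. n \<ge> N \<Longrightarrow> J n > g"
    unfolding eventually_sequentially by blast
  define c where "c = real d / (2 * pi) * g"
  have lower: "c / sqrt (real n) \<le> lprob p n {xs. sum_list xs = 0}"
    if "n \<ge> N" "int d dvd int n * x0" for n
  proof (cases "n = 0")
    case False
    have "lprob p n {xs. sum_list xs = 0} = real d / (2 * pi) * (\<integral>t. indicator ?I t * Re (cf p t ^ n) \<partial>lborel)"
      using fourier[of 0 n] that(2) by simp
    also have "(\<integral>t. indicator ?I t * Re (cf p t ^ n) \<partial>lborel) = J n / sqrt (real n)"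
      using False by (subst lborel_integral_real_affine[where c = "1 / sqrt (real n)" and t = 0]) (simp_all add: J_def)
    finally have "lprob p n {xs. sum_list xs = 0} = real d / (2 * pi) * (J n / sqrt (real n))" .
    moreover have "g / sqrt (real n) \<le> J n / sqrt (real n)"
      using N[OF that(1)] by (intro divide_right_mono) auto
    then have "real d / (2 * pi) * (g / sqrt (real n)) \<le> real d / (2 * pi) * (J n / sqrt (real n))"
      by (intro mult_left_mono) auto
    ultimately show ?thesis by (simp add: c_def)
  qed simp
  show ?thesis
  proof (rule that[of d C c x0 N])
    show "C > 0" "c > 0" using d b g by (simp_all add: C_def c_def)
    show "int d dvd int n * x0" if "lprob p n {xs. sum_list xs = 0} > 0" for n
      using in_lattice[OF that] by simp
  qed (use d upper lower in blast)+
qed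

end

section \<open>Bridges whose area is positive at their returns\<close>

definition strict_pers :: "int list set" where
  "strict_pers = {xs. \<forall>k\<in>{1..length xs}. pos xs k = 0 \<longrightarrow> 0 < area xs k}"

definition weak_pers :: "int list set" where
  "weak_pers = {xs. \<forall>k\<in>{1..length xs}. pos xs k = 0 \<longrightarrow> 0 \<le> area xs k}"

definition bridges :: "int list set" where
  "bridges = {xs. sum_list xs = 0}"

definition no_return :: "int list set" where
  "no_return = {xs. \<forall>k\<in>{1..length xs}. pos xs k \<noteq> 0}"

lemma take_bridge_iff: "take j zs \<in> bridges \<longleftrightarrow> pos zs j = 0"
  by (simp add: bridges_def pos_def)

lemma rev_bridge_iff [simp]: "rev zs \<in> bridges \<longleftrightarrow> zs \<in> bridges"
  by (simp add: bridges_def sum_list_rev)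

lemma drop_bridge_iff:
  assumes "take j zs \<in> bridges"
  shows "drop j zs \<in> bridges \<longleftrightarrow> zs \<in> bridges"
proof -
  have "sum_list zs = sum_list (take j zs) + sum_list (drop j zs)"
    by (metis append_take_drop_id sum_list_append)
  with assms show ?thesis by (simp add: bridges_def)
qed

text \<open>
  Time reversal exchanges persistence with ending at a strict record low of the area.
\<close>

lemma rev_strict_pers_iff:
  assumes "zs \<in> bridges"
  shows "rev zs \<in> strict_pers \<longleftrightarrow> (\<forall>k<length zs. pos zs k = 0 \<longrightarrow> area zs (length zs) < area zs k)"
proof -
  have sum: "sum_list zs = 0" using assms by (simp add: bridges_def)
  have "rev zs \<in> strict_pers \<longleftrightarrow> (\<forall>k\<in>{1..length zs}. pos zs (length zs - k) = 0 \<longrightarrow>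
      area zs (length zs) < area zs (length zs - k))"
    unfolding strict_pers_def using sum by (auto simp: pos_rev area_rev)
  also have "\<dots> \<longleftrightarrow> (\<forall>k<length zs. pos zs k = 0 \<longrightarrow> area zs (length zs) < area zs k)" (is "?L \<longleftrightarrow> ?R")
  proof
    assume L: ?L
    show ?R
    proof (intro allI impI)
      fix k assume "k < length zs" "pos zs k = 0"
      with L[rule_format, of "length zs - k"] show "area zs (length zs) < area zs k" by auto
    qed
  qed auto
  finally show ?thesis .
qed

lemma rev_weak_pers_iff:
  assumes "zs \<in> bridges"
  shows "rev zs \<in> weak_pers \<longleftrightarrow> (\<forall>k<length zs. pos zs k = 0 \<longrightarrow> area zs (length zs) \<le> area zs k)"
proof -
  have sum: "sum_list zs = 0" using assms by (simp add: bridges_def)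
  have "rev zs \<in> weak_pers \<longleftrightarrow> (\<forall>k\<in>{1..length zs}. pos zs (length zs - k) = 0 \<longrightarrow>
      area zs (length zs) \<le> area zs (length zs - k))"
    unfolding weak_pers_def using sum by (auto simp: pos_rev area_rev)
  also have "\<dots> \<longleftrightarrow> (\<forall>k<length zs. pos zs k = 0 \<longrightarrow> area zs (length zs) \<le> area zs k)" (is "?L \<longleftrightarrow> ?R")
  proof
    assume L: ?L
    show ?R
    proof (intro allI impI)
      fix k assume "k < length zs" "pos zs k = 0"
      with L[rule_format, of "length zs - k"] show "area zs (length zs) \<le> area zs k" by auto
    qed
  qed auto
  finally show ?thesis .
qed

lemma take_strict_persI: "zs \<in> strict_pers \<Longrightarrow> take m zs \<in> strict_pers"
  by (auto simp: strict_pers_def pos_take area_take)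

text \<open>
  A bridge has at most one return at which the area is strictly below its values at all other
  returns. Cutting there, the second piece is persistent and the first one is the reversal of a
  persistent bridge.
\<close>

lemma strict_bridge_convolution:
  "(\<Sum>j\<le>n. lprob p j (bridges \<inter> strict_pers) * lprob p (n - j) (bridges \<inter> strict_pers))
     \<le> lprob p n bridges"
proof -
  let ?W = "bridges \<inter> strict_pers"
  let ?E = "\<lambda>j. {zs. take j zs \<in> {xs. rev xs \<in> ?W} \<and> drop j zs \<in> ?W}"
  have "(\<Sum>j\<le>n. lprob p j ?W * lprob p (n - j) ?W) = (\<Sum>j\<le>n. lprob p n (?E j))"
    using lprob_split_prod'[where A = "{xs. rev xs \<in> ?W}" and B = ?W]
    by (intro sum.cong refl) (simp only: lprob_rev atMost_iff)
  also have "\<dots> \<le> lprob p n bridges"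
  proof (rule sum_lprob_le)
    fix zs :: "int list" and j assume "length zs = n" "j \<in> {..n}" "zs \<in> ?E j"
    then show "zs \<in> bridges" using drop_bridge_iff[of j zs] by auto
  next
    fix zs :: "int list" and i j
    assume n: "length zs = n" and ij: "i \<in> {..n}" "j \<in> {..n}" "i < j" and zs: "zs \<in> ?E i" "zs \<in> ?E j"
    have zero: "pos zs i = 0" "pos zs j = 0"
      using zs by (auto simp: take_bridge_iff)
    have len: "length (take j zs) = j" using n ij by simp
    have "rev (take j zs) \<in> strict_pers" "take j zs \<in> bridges" using zs(2) by auto
    then have "area zs j < area zs i"
      using ij zero n len by (simp add: rev_strict_pers_iff pos_take area_take)
    moreover have "drop i zs \<in> strict_pers" using zs(1) by auto
    then have "0 < area (drop i zs) (j - i)"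
      unfolding strict_pers_def using n ij zero
      by (auto simp: pos_drop dest!: bspec[of _ _ "j - i"])
    then have "area zs i < area zs j" using ij zero by (simp add: area_drop)
    ultimately show False by simp
  qed simp
  finally show ?thesis .
qed

text \<open>
  The same cut at some return of minimal area, which every bridge has; the inequalities between
  areas are now weak.
\<close>

lemma weak_bridge_convolution:
  "lprob p n bridges \<le>
     (\<Sum>j\<le>n. lprob p j (bridges \<inter> weak_pers) * lprob p (n - j) (bridges \<inter> weak_pers))"
proof -
  let ?W = "bridges \<inter> weak_pers"
  let ?E = "\<lambda>j. {zs. take j zs \<in> {xs. rev xs \<in> ?W} \<and> drop j zs \<in> ?W}"
  have "lprob p n bridges \<le> (\<Sum>j\<le>n. lprob p n (?E j))"
  proof (rule lprob_le_sum)
    fix zs :: "int list" assume n: "length zs = n" and zs: "zs \<in> bridges"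
    let ?Z = "{k. k \<le> n \<and> pos zs k = 0}"
    define j where "j = arg_min_on (area zs) ?Z"
    have Z: "finite ?Z" "?Z \<noteq> {}" by (auto intro: exI[of _ 0])
    have j: "j \<le> n" "pos zs j = 0"
      using arg_min_if_finite(1)[OF Z, of "area zs"] by (auto simp: j_def)
    have min: "area zs j \<le> area zs k" if "k \<le> n" "pos zs k = 0" for k
      using arg_min_least[OF Z, of k "area zs"] that by (simp add: j_def)
    have "take j zs \<in> bridges" "drop j zs \<in> bridges"
      using zs j(2) drop_bridge_iff[of j zs] by (simp_all add: take_bridge_iff)
    moreover have "rev (take j zs) \<in> weak_pers"
      using \<open>take j zs \<in> bridges\<close> j n min by (simp add: rev_weak_pers_iff pos_take area_take)
    moreover have "drop j zs \<in> weak_pers"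
      unfolding weak_pers_def using j n min by (auto simp: pos_drop area_drop)
    ultimately show "\<exists>j\<in>{..n}. zs \<in> ?E j" using j by auto
  qed simp
  also have "\<dots> = (\<Sum>j\<le>n. lprob p j ?W * lprob p (n - j) ?W)"
    using lprob_split_prod'[where A = "{xs. rev xs \<in> ?W}" and B = ?W]
    by (intro sum.cong refl) (simp only: lprob_rev atMost_iff)
  finally show ?thesis .
qed

lemma last_return_convolution:
  "(\<Sum>j\<le>n. lprob p j bridges * lprob p (n - j) no_return) \<le> 1"
proof -
  let ?E = "\<lambda>j. {zs. take j zs \<in> bridges \<and> drop j zs \<in> no_return}"
  have "(\<Sum>j\<le>n. lprob p j bridges * lprob p (n - j) no_return) = (\<Sum>j\<le>n. lprob p n (?E j))"
    by (intro sum.cong refl) (simp add: lprob_split_prod')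
  also have "\<dots> \<le> lprob p n UNIV"
  proof (rule sum_lprob_le)
    fix zs :: "int list" and i j
    assume "length zs = n" "i \<in> {..n}" "j \<in> {..n}" "i < j" "zs \<in> ?E i" "zs \<in> ?E j"
    then show False
      unfolding no_return_def
      by (auto simp: take_bridge_iff pos_drop dest!: bspec[of _ _ "j - i"])
  qed auto
  finally show ?thesis by simp
qed

text \<open>
  Cut at the last return.
\<close>

lemma strict_pers_convolution:
  "lprob p n strict_pers \<le> (\<Sum>j\<le>n. lprob p j (bridges \<inter> strict_pers) * lprob p (n - j) no_return)"
proof -
  let ?E = "\<lambda>j. {zs. take j zs \<in> bridges \<inter> strict_pers \<and> drop j zs \<in> no_return}"
  have "lprob p n strict_pers \<le> (\<Sum>j\<le>n. lprob p n (?E j))"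
  proof (rule lprob_le_sum)
    fix zs :: "int list" assume n: "length zs = n" and zs: "zs \<in> strict_pers"
    let ?Z = "{k. k \<le> n \<and> pos zs k = 0}"
    have Z: "finite ?Z" "?Z \<noteq> {}" by (auto intro: exI[of _ 0])
    have j: "Max ?Z \<le> n" "pos zs (Max ?Z) = 0"
      using Max_in[OF Z] by auto
    have "drop (Max ?Z) zs \<in> no_return"
      unfolding no_return_def
    proof (intro CollectI ballI notI)
      fix k assume k: "k \<in> {1..length (drop (Max ?Z) zs)}" "pos (drop (Max ?Z) zs) k = 0"
      then have "Max ?Z + k \<in> ?Z" using j n by (auto simp: pos_drop)
      then have "Max ?Z + k \<le> Max ?Z" using Z(1) by (rule Max_ge[rotated])
      then show False using k by simp
    qed
    then show "\<exists>j\<in>{..n}. zs \<in> ?E j"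
      using j take_strict_persI[OF zs] by (auto simp: take_bridge_iff)
  qed simp
  also have "\<dots> = (\<Sum>j\<le>n. lprob p j (bridges \<inter> strict_pers) * lprob p (n - j) no_return)"
    by (intro sum.cong refl lprob_split_prod') simp
  finally show ?thesis .
qed

lemma strict_pers_antimono:
  assumes "m \<le> n"
  shows "lprob p n strict_pers \<le> lprob p m strict_pers"
proof -
  have "lprob p n strict_pers \<le> lprob p n {zs. take m zs \<in> strict_pers}"
    by (rule lprob_mono) (simp add: take_strict_persI)
  then show ?thesis by (simp add: lprob_take[OF assms])
qed

text \<open>
  The square \<open>{..N} \<times> {..N}\<close> lies in the triangle \<open>i + j \<le> 2 * N\<close>.
\<close>

lemma convolution_sum_le:
  fixes a b c :: "nat \<Rightarrow> real"
  assumes "\<And>n. (\<Sum>j\<le>n. a j * b (n - j)) \<le> c n" "\<And>n. 0 \<le> a n" "\<And>n. 0 \<le> b n"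
  shows "(\<Sum>j\<le>N. a j) * (\<Sum>j\<le>N. b j) \<le> (\<Sum>n\<le>2 * N. c n)"
proof -
  have fin: "finite {(i, j). i + j \<le> 2 * N}"
    by (rule finite_subset[of _ "{..2 * N} \<times> {..2 * N}"]) auto
  have "(\<Sum>j\<le>N. a j) * (\<Sum>j\<le>N. b j) = (\<Sum>(i, j)\<in>{..N} \<times> {..N}. a i * b j)"
    by (simp add: sum_product sum.cartesian_product)
  also have "\<dots> \<le> (\<Sum>(i, j)\<in>{(i, j). i + j \<le> 2 * N}. a i * b j)"
    by (rule sum_mono2[OF fin]) (use assms in auto)
  also have "\<dots> = (\<Sum>n\<le>2 * N. \<Sum>j\<le>n. a j * b (n - j))"
    by (rule sum.triangle_reindex_eq)
  also have "\<dots> \<le> (\<Sum>n\<le>2 * N. c n)"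
    by (intro sum_mono assms)
  finally show ?thesis .
qed

text \<open>
  The triangle \<open>i + j \<le> N\<close> lies in the square \<open>{..N} \<times> {..N}\<close>.
\<close>

lemma convolution_sum_ge:
  fixes a b c :: "nat \<Rightarrow> real"
  assumes "\<And>n. c n \<le> (\<Sum>j\<le>n. a j * b (n - j))" "\<And>n. 0 \<le> a n" "\<And>n. 0 \<le> b n"
  shows "(\<Sum>n\<le>N. c n) \<le> (\<Sum>j\<le>N. a j) * (\<Sum>j\<le>N. b j)"
proof -
  have "(\<Sum>n\<le>N. c n) \<le> (\<Sum>n\<le>N. \<Sum>j\<le>n. a j * b (n - j))"
    by (intro sum_mono assms)
  also have "\<dots> = (\<Sum>(i, j)\<in>{(i, j). i + j \<le> N}. a i * b j)"
    by (rule sum.triangle_reindex_eq[symmetric])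
  also have "\<dots> \<le> (\<Sum>(i, j)\<in>{..N} \<times> {..N}. a i * b j)"
    by (rule sum_mono2) (use assms in auto)
  also have "\<dots> = (\<Sum>j\<le>N. a j) * (\<Sum>j\<le>N. b j)"
    by (simp add: sum_product sum.cartesian_product)
  finally show ?thesis .
qed

lemma sum_inverse_sqrt_le: "(\<Sum>n=1..M. 1 / sqrt (real n)) \<le> 2 * sqrt (real M)"
proof (induction M)
  case (Suc M)
  have "1 / sqrt (real (Suc M)) \<le> 2 * sqrt (real (Suc M)) - 2 * sqrt (real M)"
  proof -
    let ?x = "sqrt (real (Suc M))" and ?y = "sqrt (real M)"
    have "?x\<^sup>2 - ?y\<^sup>2 = 1" "?x > 0" "0 \<le> ?y" by auto
    moreover have "0 \<le> (?x - ?y)\<^sup>2" by simp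
    ultimately have "1 \<le> (2 * ?x - 2 * ?y) * ?x"
      by (simp add: power2_eq_square algebra_simps)
    then show ?thesis using \<open>?x > 0\<close> by (simp add: divide_le_eq)
  qed
  with Suc show ?case by simp
qed simp


section \<open>Upper bound\<close>

text \<open>
  The conclusions of \<open>local_limit_estimates\<close> as hypotheses: the arguments on paths that follow do
  not refer to characteristic functions or moments.
\<close>

locale lattice_step =
  fixes p :: "int pmf" and d :: nat and a :: int and C c :: real and N\<^sub>0 :: nat
  assumes span_pos: "d > 0" and C_pos: "C > 0" and c_pos: "c > 0"
    and point_prob_le: "\<And>n x. n \<ge> 1 \<Longrightarrow> lprob p n {xs. sum_list xs = x} \<le> C / sqrt (real n)"
    and return_lattice: "\<And>n. lprob p n bridges > 0 \<Longrightarrow> int d dvd int n * a"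
    and return_prob_ge:
      "\<And>n. n \<ge> N\<^sub>0 \<Longrightarrow> int d dvd int n * a \<Longrightarrow> c / sqrt (real n) \<le> lprob p n bridges"
begin

lemma sum_return_prob_le:
  assumes "M \<ge> 1"
  shows "(\<Sum>n\<le>M. lprob p n bridges) \<le> (1 + 2 * C) * sqrt (real M)"
proof -
  have "(\<Sum>n\<le>M. lprob p n bridges) = lprob p 0 bridges + (\<Sum>n=1..M. lprob p n bridges)"
    by (simp add: atMost_atLeast0 sum.atLeast_Suc_atMost)
  also have "\<dots> \<le> 1 + (\<Sum>n=1..M. C * (1 / sqrt (real n)))"
    using point_prob_le[of _ 0] by (intro add_mono sum_mono) (auto simp: bridges_def)
  also have "\<dots> = 1 + C * (\<Sum>n=1..M. 1 / sqrt (real n))"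
    by (simp add: sum_distrib_left)
  also have "\<dots> \<le> sqrt (real M) + C * (2 * sqrt (real M))"
    using assms C_pos sum_inverse_sqrt_le[of M] by (intro add_mono mult_left_mono) auto
  finally show ?thesis by (simp add: algebra_simps)
qed

text \<open>
  The multiples of \<open>d\<close> have density \<open>1 / d\<close> and satisfy the divisibility condition for a return.
\<close>

lemma sum_return_prob_ge:
  "\<exists>b>0. \<exists>M\<^sub>0. \<forall>M\<ge>M\<^sub>0. b * sqrt (real M) \<le> (\<Sum>n\<le>M. lprob p n bridges)"
proof (intro exI conjI allI impI)
  show "c / (2 * real d) > 0" using c_pos span_pos by simp
  fix M assume M: "M \<ge> 2 * (N\<^sub>0 + 1) * d + 1"
  let ?K = "{N\<^sub>0 + 1..M div d}"
  have inj: "inj_on (\<lambda>k. k * d) ?K" using span_pos by (auto simp: inj_on_def)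
  have "c / (2 * real d) * sqrt (real M) = (real M / (2 * real d)) * (c / sqrt (real M))"
  proof -
    have "real M = sqrt (real M) * sqrt (real M)" by simp
    then show ?thesis using M by (simp add: divide_simps)
  qed
  also have "\<dots> \<le> real (card ?K) * (c / sqrt (real M))"
  proof (intro mult_right_mono)
    have "real M / real d < real (M div d) + 1"
      using span_pos by (simp add: divide_less_eq) 
        (metis add.commute dividend_less_times_div mult.commute of_nat_1 of_nat_add of_nat_less_iff of_nat_mult plus_1_eq_Suc mult_Suc_right)
    moreover have "2 * (real N\<^sub>0 + 1) \<le> real M / real d"
    proof -
      have "real (2 * (N\<^sub>0 + 1) * d + 1) \<le> real M" using M by (rule of_nat_mono)
      then show ?thesis using span_pos by (simp add: le_divide_eq algebra_simps)
    qed
    moreover have "real (card ?K) \<ge> real (M div d) - real N\<^sub>0" by simp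
    ultimately show "real M / (2 * real d) \<le> real (card ?K)" by (simp add: field_simps)
  qed (use c_pos in simp)
  also have "\<dots> = (\<Sum>k\<in>?K. c / sqrt (real M))" by simp
  also have "\<dots> \<le> (\<Sum>k\<in>?K. lprob p (k * d) bridges)"
  proof (rule sum_mono)
    fix k assume k: "k \<in> ?K"
    then have "k * d \<le> M" by (metis atLeastAtMost_iff div_times_less_eq_dividend mult_le_mono1 order_trans)
    have "N\<^sub>0 \<le> k * d" "0 < k * d" using k span_pos by (auto intro: order.trans[of _ k])
    then have "0 < real (k * d)" "real (k * d) \<le> real M"
      using \<open>k * d \<le> M\<close> by (simp_all only: of_nat_0_less_iff of_nat_le_iff)
    then have "c / sqrt (real M) \<le> c / sqrt (real (k * d))"
      using c_pos by (intro divide_left_mono real_sqrt_le_mono mult_pos_pos real_sqrt_gt_zero) linarith+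
    also have "\<dots> \<le> lprob p (k * d) bridges"
      using \<open>N\<^sub>0 \<le> k * d\<close> by (intro return_prob_ge) auto
    finally show "c / sqrt (real M) \<le> lprob p (k * d) bridges" .
  qed
  also have "\<dots> = (\<Sum>n\<in>(\<lambda>k. k * d) ` ?K. lprob p n bridges)"
    by (simp only: sum.reindex[OF inj] o_def)
  also have "\<dots> \<le> (\<Sum>n\<le>M. lprob p n bridges)"
    by (rule sum_mono2)
       (auto, metis div_times_less_eq_dividend mult_le_mono1 order_trans)
  finally show "c / (2 * real d) * sqrt (real M) \<le> (\<Sum>n\<le>M. lprob p n bridges)" .
qed

text \<open>
  The convolution inequality controls sums of \<open>w\<close> only. Monotonicity is available for \<open>q\<close>, the
  probability of persistence without the bridge condition, and halving the time interval transfers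
  the bound back to \<open>w\<close>.
\<close>

lemma strict_bridge_prob_le:
  "\<exists>K M\<^sub>0. \<forall>n\<ge>M\<^sub>0. lprob p n (bridges \<inter> strict_pers) \<le> K * real n powr (-3/4)"
proof -
  let ?w = "\<lambda>n. lprob p n (bridges \<inter> strict_pers)"
  let ?r = "\<lambda>n. lprob p n no_return"
  let ?q = "\<lambda>n. lprob p n strict_pers"
  define K1 where "K1 = (1 + 2 * C) * sqrt 2"
  have K1: "K1 > 0" using C_pos by (simp add: K1_def)
  have w: "(\<Sum>j\<le>M. ?w j) \<le> sqrt K1 * real M powr (1/4)" if "M \<ge> 1" for M
  proof -
    have "(\<Sum>j\<le>M. ?w j)\<^sup>2 \<le> (\<Sum>n\<le>2 * M. lprob p n bridges)"
      unfolding power2_eq_square by (rule convolution_sum_le[OF strict_bridge_convolution]) auto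
    also have "\<dots> \<le> (1 + 2 * C) * sqrt (real (2 * M))"
      using that by (intro sum_return_prob_le) simp
    also have "\<dots> = K1 * sqrt (real M)" by (simp add: K1_def real_sqrt_mult)
    also have "\<dots> = (sqrt K1 * real M powr (1/4))\<^sup>2"
    proof -
      have "(real M powr (1/4))\<^sup>2 = sqrt (real M)"
        by (simp add: power2_eq_square powr_add[symmetric] powr_half_sqrt)
      then show ?thesis using K1 by (simp add: power_mult_distrib)
    qed
    finally show ?thesis by (rule power2_le_imp_le) (use K1 in simp)
  qed
  obtain b M1 where b: "b > 0" and M1: "\<And>M. M \<ge> M1 \<Longrightarrow> b * sqrt (real M) \<le> (\<Sum>n\<le>M. lprob p n bridges)"
    using sum_return_prob_ge by blast
  have r: "(\<Sum>j\<le>M. ?r j) \<le> 3 / b * sqrt (real M)" if "M \<ge> 1" "M \<ge> M1" for M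
  proof -
    have "(b * sqrt (real M)) * (\<Sum>j\<le>M. ?r j) \<le> (\<Sum>j\<le>M. lprob p j bridges) * (\<Sum>j\<le>M. ?r j)"
      using that by (intro mult_right_mono M1 sum_nonneg) auto
    also have "\<dots> \<le> (\<Sum>n\<le>2 * M. 1)"
      by (rule convolution_sum_le[OF last_return_convolution]) auto
    also have "\<dots> \<le> 3 * real M" using that by simp
    also have "\<dots> = (b * sqrt (real M)) * (3 / b * sqrt (real M))"
      using b by simp
    finally show ?thesis using b that by (subst (asm) mult_le_cancel_left_pos) auto
  qed
  define K2 where "K2 = sqrt K1 * (3 / b)"
  have K2: "K2 > 0" using b K1 by (simp add: K2_def)
  have q: "?q M \<le> K2 * real M powr (-1/4)" if "M \<ge> 1" "M \<ge> M1" for M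
  proof -
    have "real M * ?q M = (\<Sum>n=1..M. ?q M)" by simp
    also have "\<dots> \<le> (\<Sum>n=1..M. ?q n)"
      by (intro sum_mono strict_pers_antimono) simp
    also have "\<dots> \<le> (\<Sum>n\<le>M. ?q n)"
      by (intro sum_mono2) auto
    also have "\<dots> \<le> (\<Sum>j\<le>M. ?w j) * (\<Sum>j\<le>M. ?r j)"
      by (rule convolution_sum_ge[OF strict_pers_convolution]) auto
    also have "\<dots> \<le> (sqrt K1 * real M powr (1/4)) * (3 / b * sqrt (real M))"
      using that K1 by (intro mult_mono w r sum_nonneg) auto
    also have "\<dots> = K2 * (real M powr (1/4) * real M powr (1/2))"
      by (simp add: K2_def powr_half_sqrt)
    also have "real M powr (1/4) * real M powr (1/2) = real M * real M powr (-1/4)"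
      using that by (simp add: powr_add[symmetric] powr_mult_base)
    finally show ?thesis
      using that by (simp add: mult.left_commute[of K2])
  qed
  define K where "K = K2 * 3 powr (1/4) * (C * sqrt 2)"
  have "?w n \<le> K * real n powr (-3/4)" if n: "n \<ge> 2 * M1 + 2" for n
  proof -
    let ?m = "n div 2"
    have m: "?m \<ge> 1" "?m \<ge> M1" "n - ?m \<ge> 1" "n \<le> 3 * ?m" "n \<le> 2 * (n - ?m)"
      using n by linarith+
    from m(4,5) have "real n \<le> real (3 * ?m)" "real n \<le> real (2 * (n - ?m))"
      by (simp_all only: of_nat_le_iff)
    then have half: "real n / 3 \<le> real ?m" "real n / 2 \<le> real (n - ?m)"
      by simp_all
    have "?w n \<le> lprob p (?m + (n - ?m)) {zs. take ?m zs \<in> strict_pers \<and> sum_list zs = 0}"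
      using take_strict_persI by (auto simp: bridges_def intro!: lprob_mono)
    also have "\<dots> \<le> ?q ?m * (C / sqrt (real (n - ?m)))"
      by (rule lprob_split_bound) (rule point_prob_le[OF m(3)])
    also have "\<dots> \<le> (K2 * (real n / 3) powr (-1/4)) * (C / sqrt (real n / 2))"
    proof (intro mult_mono)
      have "real ?m powr (-1/4) \<le> (real n / 3) powr (-1/4)"
        using half(1) n by (intro powr_mono2') auto
      with q[OF m(1,2)] K2 show "?q ?m \<le> K2 * (real n / 3) powr (-1/4)"
        by (meson mult_left_mono order.trans less_imp_le)
      show "C / sqrt (real (n - ?m)) \<le> C / sqrt (real n / 2)"
        using half(2) m(3) C_pos n by (intro divide_left_mono real_sqrt_le_mono mult_pos_pos) auto
    qed (use K2 C_pos in auto)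
    also have "(real n / 3) powr (-1/4) = 3 powr (1/4) * real n powr (-1/4)"
      using n by (simp add: powr_divide powr_minus divide_simps)
    also have "C / sqrt (real n / 2) = C * sqrt 2 * real n powr (-1/2)"
      using n by (simp add: real_sqrt_divide powr_minus powr_half_sqrt divide_simps)
    also have "(K2 * (3 powr (1/4) * real n powr (-1/4))) * (C * sqrt 2 * real n powr (-1/2))
       = K * (real n powr (-1/4) * real n powr (-1/2))" by (simp add: K_def)
    also have "real n powr (-1/4) * real n powr (-1/2) = real n powr (-3/4)"
      by (simp add: powr_add[symmetric])
    finally show ?thesis .
  qed
  then show ?thesis by blast
qed

end

section \<open>Records of the area and rotations of bridges\<close>

text \<open>
  The time reversals of the bridges in \<open>weak_pers\<close>. In this form the successive records of the area
  cut a path into pieces of the same kind.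
\<close>

definition record_bridges :: "int list set" where
  "record_bridges = {xs\<in>bridges. \<forall>k<length xs. pos xs k = 0 \<longrightarrow> area xs (length xs) \<le> area xs k}"

definition late_record_bridges :: "nat \<Rightarrow> int list set" where
  "late_record_bridges i = {xs\<in>record_bridges. \<forall>t\<in>{1..i}. take t xs \<notin> record_bridges}"

text \<open>
  By summation of tails this is the mean of the time of the first record after 0 (at most \<open>k\<close>), on
  the event that \<open>k\<close> is a record. The tail form needs no name for that time.
\<close>

definition record_gap :: "int pmf \<Rightarrow> nat \<Rightarrow> real" where
  "record_gap p k = (\<Sum>i<k. lprob p k (late_record_bridges i))"

lemma lprob_record_bridges: "lprob p n record_bridges = lprob p n (bridges \<inter> weak_pers)"
proof -
  have "record_bridges = {xs. rev xs \<in> bridges \<inter> weak_pers}"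
    by (auto simp: record_bridges_def rev_weak_pers_iff)
  then show ?thesis using lprob_rev[where B = "bridges \<inter> weak_pers"] by simp
qed

lemma record_bridges_append:
  assumes "take j zs \<in> record_bridges" "drop j zs \<in> record_bridges" "j \<le> length zs"
  shows "zs \<in> record_bridges"
proof -
  have br: "take j zs \<in> bridges" "drop j zs \<in> bridges"
    using assms by (auto simp: record_bridges_def)
  then have j0: "pos zs j = 0" by (simp add: take_bridge_iff)
  have later: "area zs (length zs) \<le> area zs k" if "j \<le> k" "k < length zs" "pos zs k = 0" for k
    using assms(2) that j0 unfolding record_bridges_def
    by (auto simp: pos_drop area_drop dest!: spec[of _ "k - j"])
  have before: "area zs j \<le> area zs k" if "k < j" "pos zs k = 0" for k
    using assms(1,3) that unfolding record_bridges_def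
    by (auto simp: pos_take area_take dest!: spec[of _ k])
  have "area zs (length zs) \<le> area zs j"
    using later[of j] j0 assms(3) by (cases "j = length zs") auto
  then have "area zs (length zs) \<le> area zs k" if "k < j" "pos zs k = 0" for k
    using before[OF that] by linarith
  with later have "area zs (length zs) \<le> area zs k" if "k < length zs" "pos zs k = 0" for k
    using that by (cases "k < j") auto
  with br drop_bridge_iff[OF br(1)] show ?thesis by (simp add: record_bridges_def)
qed

lemma record_bridges_between:
  assumes "take b zs \<in> record_bridges" "pos zs a = 0" "a \<le> b" "b \<le> length zs"
  shows "take (b - a) (drop a zs) \<in> record_bridges"
proof -
  have b0: "pos zs b = 0"
    using assms(1) by (simp add: record_bridges_def take_bridge_iff)
  have min: "area zs b \<le> area zs k" if "k < b" "pos zs k = 0" for k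
    using assms(1,4) that by (auto simp: record_bridges_def pos_take area_take)
  have "length (take (b - a) (drop a zs)) = b - a" using assms by simp
  moreover have "pos (take (b - a) (drop a zs)) k = pos zs (a + k)"
    "area (take (b - a) (drop a zs)) k = area zs (a + k) - area zs a" if "k \<le> b - a" for k
    using that assms(2) by (simp_all add: pos_take pos_drop area_take area_drop)
  ultimately show ?thesis
    unfolding record_bridges_def using assms(2,3) b0 min
    by (simp add: take_bridge_iff pos_drop)
qed

text \<open>
  For each \<open>m < n\<close>, a path that has a record at \<open>n\<close> is cut at its last record \<open>a\<close> not after \<open>m\<close>;
  then the first gap of the second piece exceeds \<open>m - a\<close>. Summation over \<open>m\<close> gives the factor \<open>n\<close>.
\<close>

lemma record_renewal_inequality:
  "(\<Sum>a<n. lprob p a (bridges \<inter> weak_pers) * record_gap p (n - a))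
     \<le> real n * lprob p n (bridges \<inter> weak_pers)"
proof -
  let ?E = "\<lambda>a i. {zs. take a zs \<in> record_bridges \<and> drop a zs \<in> late_record_bridges i}"
  have "(\<Sum>a<n. lprob p a (bridges \<inter> weak_pers) * record_gap p (n - a))
      = (\<Sum>a<n. \<Sum>i<n - a. lprob p n (?E a i))"
    unfolding record_gap_def sum_distrib_left lprob_record_bridges[symmetric]
    by (intro sum.cong refl lprob_split_prod'[symmetric]) simp
  also have "\<dots> = (\<Sum>(a, i)\<in>{(a, i). a + i < n}. lprob p n (?E a i))"
  proof -
    have "Sigma {..<n} (\<lambda>a. {..<n - a}) = {(a, i). a + i < n}" by auto
    then show ?thesis by (simp only: sum.Sigma[OF finite_lessThan ballI[OF finite_lessThan]])
  qed
  also have "\<dots> = (\<Sum>m<n. \<Sum>a\<le>m. lprob p n (?E a (m - a)))"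
    by (rule sum.triangle_reindex)
  also have "\<dots> \<le> (\<Sum>m<n. lprob p n record_bridges)"
  proof (rule sum_mono)
    fix m assume m: "m \<in> {..<n}"
    show "(\<Sum>a\<le>m. lprob p n (?E a (m - a))) \<le> lprob p n record_bridges"
    proof (rule sum_lprob_le)
      fix zs :: "int list" and j
      assume "length zs = n" "j \<in> {..m}" "zs \<in> ?E j (m - j)"
      then show "zs \<in> record_bridges"
        using m record_bridges_append[of j zs] by (auto simp: late_record_bridges_def)
    next
      fix zs :: "int list" and i j
      assume *: "length zs = n" "i \<in> {..m}" "j \<in> {..m}" "i < j"
        "zs \<in> ?E i (m - i)" "zs \<in> ?E j (m - j)"
      then have "pos zs i = 0" by (auto simp: record_bridges_def take_bridge_iff)
      then have "take (j - i) (drop i zs) \<in> record_bridges"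
        using * m record_bridges_between[of j zs i] by auto
      moreover have "j - i \<in> {1..m - i}" using * by auto
      ultimately show False using *(5) unfolding late_record_bridges_def by blast
    qed simp
  qed
  also have "\<dots> = real n * lprob p n (bridges \<inter> weak_pers)"
    by (simp add: lprob_record_bridges)
  finally show ?thesis .
qed

text \<open>
  Continue the path periodically and measure areas relative to the level \<open>l\<close>. As the area over one
  period is not positive, the last minimizer \<open>t\<close> of this area among the visits to \<open>l\<close> in
  \<open>{1..k}\<close> is a record with respect to the whole past, and no later time in the period is a record.
  Starting the period at \<open>t\<close> gives a record bridge without records up to time \<open>k - t\<close>, and \<open>l\<close> can be
  recovered from \<open>k - t\<close> as the height of the original path at \<open>t\<close>.
\<close>

lemma rotate_to_last_record:
  assumes ys: "ys \<in> bridges" "length ys = k"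
    and l: "t\<^sub>0 \<in> {1..k}" "pos ys t\<^sub>0 = l"
    and A: "area ys k \<le> int k * l"
  shows "\<exists>i<k. drop (k - i) ys @ take (k - i) ys \<in> late_record_bridges i \<and> pos ys (k - i) = l"
proof -
  define F where "F t = area ys t - int t * l" for t
  let ?Z = "{t\<in>{1..k}. pos ys t = l}"
  have Z: "finite ?Z" "?Z \<noteq> {}" using l by auto
  define m where "m = Min (F ` ?Z)"
  have m_le: "m \<le> F s" if "s \<in> ?Z" for s
    using Z that unfolding m_def by (intro Min_le) auto
  have "m \<in> F ` ?Z" unfolding m_def using Z by (intro Min_in) auto
  then have "{t\<in>?Z. F t = m} \<noteq> {}" by auto
  have finm: "finite {t\<in>?Z. F t = m}" by simp
  define t where "t = Max {t\<in>?Z. F t = m}"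
  have "t \<in> {t\<in>?Z. F t = m}" unfolding t_def by (rule Max_in[OF finm]) fact
  then have t: "1 \<le> t" "t \<le> k" "pos ys t = l" "F t = m" by auto
  have last: "s \<le> t" if "s \<in> ?Z" "F s = m" for s
    unfolding t_def using finm that by (intro Max_ge) auto
  have Fk: "F k \<le> 0" using A by (simp add: F_def)
  have sum0: "sum_list ys = 0" using ys by (simp add: bridges_def)
  have sum_drop: "sum_list (drop t ys) = - l"
  proof -
    have "sum_list ys = pos ys t + sum_list (drop t ys)"
      unfolding pos_def by (metis append_take_drop_id sum_list_append)
    then show ?thesis using sum0 t by simp
  qed
  define xs where "xs = drop t ys @ take t ys"
  have len: "length (drop t ys) = k - t" "length xs = k" using ys t by (simp_all add: xs_def)
  have pos1: "pos xs j = pos ys (t + j) - l" if "j \<le> k - t" for j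
    unfolding xs_def using that len t by (simp add: pos_append1 pos_drop)
  have area1: "area xs j = F (t + j) - F t" if "j \<le> k - t" for j
    unfolding xs_def using that len t by (simp add: area_append1 area_drop F_def algebra_simps)
  have pos2: "pos xs (k - t + j) = pos ys j - l" if "j \<le> t" for j
    unfolding xs_def using that pos_append2[of "drop t ys" "take t ys" j] len sum_drop
    by (simp add: pos_take)
  have area2: "area xs (k - t + j) = F k - F t + F j" if "j \<le> t" for j
  proof -
    have "area xs (k - t + j) = area (drop t ys) (k - t) - int j * l + area ys j"
      unfolding xs_def using that area_append2[of "drop t ys" "take t ys" j] len sum_drop
      by (simp add: area_take)
    also have "area (drop t ys) (k - t) = F k - F t"
      using t by (simp add: area_drop F_def algebra_simps of_nat_diff)
    finally show ?thesis by (simp add: F_def)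
  qed
  have "xs \<in> record_bridges"
    unfolding record_bridges_def
  proof (intro CollectI conjI allI impI)
    show "xs \<in> bridges"
      using sum_drop t(3) by (simp add: xs_def bridges_def pos_def)
    fix j assume j: "j < length xs" "pos xs j = 0"
    have final_val: "area xs (length xs) = F k" using area2[of t] t len by simp
    show "area xs (length xs) \<le> area xs j"
    proof (cases "j \<le> k - t")
      case True
      then have "t + j \<in> ?Z" using j pos1[of j] t by auto
      from m_le[OF this] show ?thesis using final_val area1[OF True] Fk t by simp
    next
      case False
      define j' where "j' = j - (k - t)"
      have j': "j = k - t + j'" "j' \<ge> 1" "j' \<le> t"
        using False j(1) len t unfolding j'_def by linarith+
      then have "j' \<in> ?Z" using j pos2[of j'] t by auto
      from m_le[OF this] show ?thesis using final_val area2[of j'] j' t by simp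
    qed
  qed
  moreover have "take s xs \<notin> record_bridges" if s: "s \<in> {1..k - t}" for s
  proof
    assume *: "take s xs \<in> record_bridges"
    then have "pos xs s = 0" by (auto simp: record_bridges_def take_bridge_iff)
    then have Z: "t + s \<in> ?Z" using pos1[of s] s by auto
    have "s \<le> k" using s unfolding atLeastAtMost_iff by linarith
    then have "length (take s xs) = s" using len by simp
    then have "area xs s \<le> area xs 0"
      using * s unfolding record_bridges_def by (auto simp: area_take dest!: spec[of _ 0])
    then have "F (t + s) \<le> F t" using area1[of s] s by simp
    with m_le[OF Z] t have "F (t + s) = m" by simp
    from last[OF Z this] s show False by simp
  qed
  ultimately have "xs \<in> late_record_bridges (k - t)" by (simp add: late_record_bridges_def)
  then show ?thesis
    using t by (intro exI[of _ "k - t"]) (simp add: xs_def)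
qed

text \<open>
  Distinct levels lead to distinct rotations, and each rotation preserves the law of the path. Hence
  the mean number of levels \<open>l\<close> that are visited and at least as high as the average height of the
  path is at most \<open>record_gap\<close>.
\<close>

lemma record_gap_ge:
  assumes "\<And>ys. length ys = k \<Longrightarrow> set ys \<subseteq> set_pmf p \<Longrightarrow> ys \<in> B \<Longrightarrow>
      ys \<in> bridges \<and> m \<le> real (card {l. (\<exists>t\<in>{1..k}. pos ys t = l) \<and> area ys k \<le> int k * l})"
  shows "m * lprob p k B \<le> record_gap p k"
proof -
  let ?E = "\<lambda>i. {ys. drop (k - i) ys @ take (k - i) ys \<in> late_record_bridges i}"
  have "m * lprob p k B \<le> (\<Sum>i<k. lprob p k (?E i))"
  proof (rule sum_lprob_ge)
    fix ys :: "int list" assume ys: "length ys = k" "set ys \<subseteq> set_pmf p" "ys \<in> B"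
    let ?L = "{l. (\<exists>t\<in>{1..k}. pos ys t = l) \<and> area ys k \<le> int k * l}"
    have "?L \<subseteq> (\<lambda>i. pos ys (k - i)) ` {i\<in>{..<k}. ys \<in> ?E i}"
    proof
      fix l assume l: "l \<in> ?L"
      then obtain t where "t \<in> {1..k}" "pos ys t = l" "area ys k \<le> int k * l" by blast
      with rotate_to_last_record[of ys k t l] assms[OF ys] ys
      obtain i where "i < k" "drop (k - i) ys @ take (k - i) ys \<in> late_record_bridges i"
        "pos ys (k - i) = l" by blast
      then show "l \<in> (\<lambda>i. pos ys (k - i)) ` {i\<in>{..<k}. ys \<in> ?E i}"
        by (intro image_eqI[of _ _ i]) auto
    qed
    then have "card ?L \<le> card {i\<in>{..<k}. ys \<in> ?E i}"
      by (rule surj_card_le[rotated]) simp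
    with assms[OF ys] show "m \<le> real (card {i\<in>{..<k}. ys \<in> ?E i})" by linarith
  qed simp
  also have "\<dots> = record_gap p k"
    unfolding record_gap_def by (intro sum.cong refl lprob_rotate) simp
  finally show ?thesis .
qed

lemma upcrossing_hits:
  assumes "\<forall>x\<in>set ys. x \<le> 1" "a \<le> b" "b \<le> length ys" "pos ys a \<le> l" "l \<le> pos ys b"
  shows "\<exists>t. a \<le> t \<and> t \<le> b \<and> pos ys t = l"
  using assms(2-)
proof (induction b rule: dec_induct)
  case base
  then show ?case by (intro exI[of _ a]) simp
next
  case (step b)
  show ?case
  proof (cases "l \<le> pos ys b")
    case True
    with step obtain t where "a \<le> t" "t \<le> b" "pos ys t = l" by auto
    then show ?thesis by (intro exI[of _ t]) simp
  next
    case False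
    have "pos ys (Suc b) \<le> pos ys b + 1"
      using step.prems assms(1)[rule_format, of "ys ! b"] by (simp add: pos_Suc)
    with False step.prems have "pos ys (Suc b) = l" by simp
    with step.hyps show ?thesis by (intro exI[of _ "Suc b"]) simp
  qed
qed

text \<open>
  An upward skip-free path cannot jump over \<open>l\<close> on its way up, and as a closed path it has to move
  up from a point at or below \<open>l\<close> to a point at or above \<open>l\<close>. For negative \<open>l\<close> the starting point of
  this move exists because \<open>l\<close> is not below the average height.
\<close>

lemma bridge_visits_level_above_mean:
  assumes step: "\<forall>x\<in>set ys. x \<le> 1" and br: "ys \<in> bridges" and k: "length ys = k" "k > 0"
    and t: "t \<le> k" "l \<le> pos ys t" and mean: "area ys k \<le> int k * l"
  shows "\<exists>s\<in>{1..k}. pos ys s = l"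
proof -
  have final_val: "pos ys k = 0" using br k by (simp add: bridges_def pos_def)
  show ?thesis
  proof (cases "l \<ge> 0")
    case True
    then obtain s where s: "s \<le> t" "pos ys s = l"
      using upcrossing_hits[OF step, of 0 t l] t k by auto
    show ?thesis
    proof (cases "s = 0")
      case True
      with s final_val k show ?thesis by (intro bexI[of _ k]) auto
    qed (use s t in auto)
  next
    case False
    have "\<exists>r\<in>{1..k}. pos ys r \<le> l"
    proof (rule ccontr)
      assume "\<not> ?thesis"
      then have "(\<Sum>r=1..k. l) < (\<Sum>r=1..k. pos ys r)"
        using k by (intro sum_strict_mono) (auto simp: not_le)
      with mean show False by (simp add: area_def)
    qed
    then obtain r where "r \<in> {1..k}" "pos ys r \<le> l" by blast
    moreover from this upcrossing_hits[OF step, of r k l] final_val k False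
    obtain s where "r \<le> s" "s \<le> k" "pos ys s = l" by auto
    ultimately show ?thesis by (intro bexI[of _ s]) auto
  qed
qed

text \<open>
  The maximum exceeds the average height by at least \<open>m\<close>; the inequality is multiplied by the
  length to stay within the integers.
\<close>

definition high_bridges :: "nat \<Rightarrow> int list set" where
  "high_bridges m = {ys\<in>bridges. \<exists>t\<le>length ys. int (length ys) * int m \<le> int (length ys) * pos ys t - area ys (length ys)}"

lemma record_gap_ge_high_bridges:
  assumes step: "\<And>x. x \<in> set_pmf p \<Longrightarrow> x \<le> 1" and k: "k > 0"
  shows "real m * lprob p k (high_bridges m) \<le> record_gap p k"
proof (rule record_gap_ge)
  fix ys :: "int list"
  assume ys: "length ys = k" "set ys \<subseteq> set_pmf p" "ys \<in> high_bridges m"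
  then obtain t where t: "t \<le> k" "int k * int m \<le> int k * pos ys t - area ys k"
    and br: "ys \<in> bridges" by (auto simp: high_bridges_def)
  let ?L = "{l. (\<exists>t\<in>{1..k}. pos ys t = l) \<and> area ys k \<le> int k * l}"
  have "{pos ys t - int m + 1..pos ys t} \<subseteq> ?L"
  proof
    fix l assume l: "l \<in> {pos ys t - int m + 1..pos ys t}"
    have "area ys k \<le> int k * (pos ys t - int m)"
      using t(2) by (simp add: right_diff_distrib)
    also have "\<dots> \<le> int k * l" using l by (intro mult_left_mono) auto
    finally have "area ys k \<le> int k * l" .
    moreover from this have "\<exists>s\<in>{1..k}. pos ys s = l"
      using step ys t(1) l br k by (intro bridge_visits_level_above_mean) auto
    ultimately show "l \<in> ?L" by auto
  qed
  moreover have "finite ?L"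
    by (rule finite_subset[of _ "pos ys ` {1..k}"]) auto
  ultimately have "card {pos ys t - int m + 1..pos ys t} \<le> card ?L" by (rule card_mono[rotated])
  with br show "ys \<in> bridges \<and> real m \<le> real (card ?L)" by simp
qed

text \<open>
  If the path is far from 0 at time \<open>j\<close>, then its maximum or its minimum is far from its average
  height, and time reversal exchanges these two cases.
\<close>

lemma high_bridges_prob_ge:
  assumes "j \<le> k"
  shows "lprob p k {ys\<in>bridges. 2 * int m \<le> \<bar>pos ys j\<bar>} \<le> 2 * lprob p k (high_bridges m)"
proof -
  have "lprob p k {ys\<in>bridges. 2 * int m \<le> \<bar>pos ys j\<bar>}
     \<le> lprob p k (high_bridges m \<union> {ys. rev ys \<in> high_bridges m})"
  proof (rule lprob_mono)
    fix ys :: "int list"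
    assume len: "length ys = k" and "ys \<in> {ys\<in>bridges. 2 * int m \<le> \<bar>pos ys j\<bar>}"
    then have br: "ys \<in> bridges" and j: "2 * int m \<le> \<bar>pos ys j\<bar>" by auto
    have sum0: "sum_list ys = 0" using br by (simp add: bridges_def)
    have high: "ys \<in> high_bridges m" if "t \<le> k" "int k * int m \<le> int k * pos ys t - area ys k" for t
      using that br len by (auto simp: high_bridges_def)
    have low: "rev ys \<in> high_bridges m" if t: "t \<le> k" "int k * int m \<le> area ys k - int k * pos ys t" for t
      unfolding high_bridges_def using t br len sum0
      by (auto simp: pos_rev area_rev intro!: exI[of _ "k - t"])
    consider "2 * int m \<le> pos ys j" "area ys k \<le> int k * int m"
      | "int k * int m \<le> area ys k" | "pos ys j \<le> - (2 * int m)" "- (int k * int m) \<le> area ys k"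
      | "area ys k \<le> - (int k * int m)"
      using j by linarith
    then show "ys \<in> high_bridges m \<union> {ys. rev ys \<in> high_bridges m}"
    proof cases
      case 1
      have "int k * (2 * int m) \<le> int k * pos ys j" using 1(1) by (rule mult_left_mono) simp
      with 1 high[OF assms] show ?thesis by (simp add: algebra_simps)
    next
      case 2
      with low[of 0] show ?thesis by simp
    next
      case 3
      have "int k * pos ys j \<le> int k * - (2 * int m)" using 3(1) by (rule mult_left_mono) simp
      with 3 low[OF assms] show ?thesis by (simp add: algebra_simps)
    next
      case 4
      with high[of 0] show ?thesis by simp
    qed
  qed
  also have "\<dots> \<le> lprob p k (high_bridges m) + lprob p k {ys. rev ys \<in> high_bridges m}"
    by (simp add: measure_Un_le)
  finally show ?thesis by (simp only: lprob_rev)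
qed

section \<open>Lower bound for upward skip-free steps\<close>

text \<open>
  Follow an excursion from zero: while the path is above zero the area increases from its value at
  the preceding return, and while it is below zero the area decreases to its value at the next
  return. Upward skip-freeness makes the path hit zero between the two phases.
\<close>

lemma weak_bridge_area_nonneg:
  assumes step: "\<forall>x\<in>set ys. x \<le> 1" and ys: "ys \<in> bridges \<inter> weak_pers"
    and k: "k \<le> length ys"
  shows "0 \<le> area ys k"
proof -
  have zero: "0 \<le> area ys k" if "k \<le> length ys" "pos ys k = 0" for k
    using ys that by (cases "k = 0") (auto simp: weak_pers_def)
  have up: "pos ys (Suc k) \<le> pos ys k + 1" if "k < length ys" for k
    using step[rule_format, of "ys ! k"] that by (simp add: pos_Suc)
  have above: "0 \<le> area ys k" if "k \<le> length ys" "0 \<le> pos ys k" for k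
    using that
  proof (induction k)
    case (Suc k)
    show ?case
    proof (cases "pos ys (Suc k) = 0")
      case True
      with Suc.prems(1) show ?thesis by (rule zero)
    next
      case False
      with up[of k] Suc have "0 \<le> area ys k" by simp
      with Suc.prems show ?thesis by simp
    qed
  qed simp
  have below: "0 \<le> area ys k" if "k \<le> length ys" "pos ys k \<le> 0" for k
    using that
  proof (induction k rule: inc_induct)
    case base
    with ys zero show ?case by (simp add: bridges_def pos_def)
  next
    case (step k)
    show ?case
    proof (cases "pos ys k = 0")
      case True
      with zero step show ?thesis by simp
    next
      case False
      with up[of k] step have "pos ys (Suc k) \<le> 0" by simp
      with step.IH show ?thesis by simp
    qed
  qed
  show ?thesis using above[OF k] below[OF k] by linarith
qed

definition positive_area :: "int list set" where
  "positive_area = {xs. \<forall>k\<in>{1..length xs}. 0 < area xs k}"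

context lattice_step
begin

text \<open>
  Bridges stay close to zero at time \<open>j\<close> only with a probability that is small relative to that of a
  bridge, if \<open>m\<close> is a small multiple of the square root of \<open>k\<close> and \<open>j\<close> is of the order of \<open>k\<close>.
\<close>

lemma middle_position_prob_le:
  assumes "j \<ge> 1" "j < k"
  shows "lprob p k {ys\<in>bridges. \<bar>pos ys j\<bar> < 2 * int m}
    \<le> (4 * real m * (C / sqrt (real j))) * (C / sqrt (real (k - j)))"
proof -
  have "lprob p k {ys\<in>bridges. \<bar>pos ys j\<bar> < 2 * int m}
     \<le> lprob p (j + (k - j)) {zs. take j zs \<in> {xs. \<bar>sum_list xs\<bar> < 2 * int m} \<and> sum_list zs = 0}"
    using assms by (auto simp: bridges_def pos_def intro!: lprob_mono)
  also have "\<dots> \<le> lprob p j {xs. \<bar>sum_list xs\<bar> < 2 * int m} * (C / sqrt (real (k - j)))"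
    by (rule lprob_split_bound) (rule point_prob_le, use assms in simp)
  also have "\<dots> \<le> (4 * real m * (C / sqrt (real j))) * (C / sqrt (real (k - j)))"
  proof (rule mult_right_mono)
    let ?J = "{- 2 * int m..<2 * int m}"
    have "lprob p j {xs. \<bar>sum_list xs\<bar> < 2 * int m} \<le> (\<Sum>x\<in>?J. lprob p j {xs. sum_list xs = x})"
      by (rule lprob_le_sum) auto
    also have "\<dots> \<le> (\<Sum>x\<in>?J. C / sqrt (real j))"
      by (intro sum_mono point_prob_le assms)
    also have "\<dots> = 4 * real m * (C / sqrt (real j))" by simp
    finally show "lprob p j {xs. \<bar>sum_list xs\<bar> < 2 * int m} \<le> 4 * real m * (C / sqrt (real j))" .
  qed (use C_pos in simp)
  finally show ?thesis .
qed

lemma record_gap_bounded_below: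
  assumes step: "\<And>x. x \<in> set_pmf p \<Longrightarrow> x \<le> 1"
  shows "\<exists>\<eta>>0. \<exists>K\<^sub>0. \<forall>k\<ge>K\<^sub>0. int d dvd int k * a \<longrightarrow> \<eta> \<le> record_gap p k"
proof -
  \<comment> \<open>With this choice the bridges that are within \<open>2 * m\<close> of zero at half time, where \<open>m\<close> is about
     \<open>\<epsilon> * sqrt k\<close>, take up at most one half of the lower bound for the probability of a bridge.\<close>
  define \<epsilon> where "\<epsilon> = c / (24 * C\<^sup>2)"
  have \<epsilon>: "\<epsilon> > 0" using c_pos C_pos by (simp add: \<epsilon>_def)
  define K0 where "K0 = max (max N\<^sub>0 2) (nat \<lceil>(2 / \<epsilon>)\<^sup>2\<rceil>)"
  have "\<epsilon> * c / 8 \<le> record_gap p k" if k: "k \<ge> K0" "int d dvd int k * a" for k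
  proof -
    have k2: "k \<ge> 2" "k \<ge> N\<^sub>0" "real k \<ge> (2 / \<epsilon>)\<^sup>2" using k by (simp_all add: K0_def)
    have sk: "sqrt (real k) > 0" using k2 by simp
    have "2 / \<epsilon> = sqrt ((2 / \<epsilon>)\<^sup>2)" using \<epsilon> by simp
    also have "\<dots> \<le> sqrt (real k)" using k2(3) by (rule real_sqrt_le_mono)
    finally have large: "2 \<le> \<epsilon> * sqrt (real k)" using \<epsilon> by (simp add: field_simps)
    define m where "m = nat \<lfloor>\<epsilon> * sqrt (real k)\<rfloor>"
    have m: "real m \<le> \<epsilon> * sqrt (real k)" "\<epsilon> * sqrt (real k) / 2 \<le> real m"
      using large unfolding m_def by linarith+
    let ?j = "k div 2"
    have j: "?j \<ge> 1" "?j < k" using k2 by auto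
    have "lprob p k {ys\<in>bridges. \<bar>pos ys ?j\<bar> < 2 * int m}
       \<le> (4 * real m * (C / sqrt (real ?j))) * (C / sqrt (real (k - ?j)))"
      using j by (rule middle_position_prob_le)
    also have "\<dots> = 4 * real m * C\<^sup>2 * (1 / (sqrt (real ?j) * sqrt (real (k - ?j))))"
      by (simp add: power2_eq_square)
    also have "\<dots> \<le> 4 * (\<epsilon> * sqrt (real k)) * C\<^sup>2 * (3 / real k)"
    proof (intro mult_mono order.refl m)
      have "k \<le> 3 * ?j" "k \<le> 3 * (k - ?j)" using k2 by linarith+
      then have "real k \<le> real (3 * ?j)" "real k \<le> real (3 * (k - ?j))"
        by (simp_all only: of_nat_le_iff)
      then have "sqrt (real k / 3) * sqrt (real k / 3) \<le> sqrt (real ?j) * sqrt (real (k - ?j))"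
        by (intro mult_mono real_sqrt_le_mono) auto
      then have "real k / 3 \<le> sqrt (real ?j) * sqrt (real (k - ?j))" by simp
      then have "1 / (sqrt (real ?j) * sqrt (real (k - ?j))) \<le> 1 / (real k / 3)"
        using k2 j by (intro divide_left_mono mult_pos_pos) auto
      then show "1 / (sqrt (real ?j) * sqrt (real (k - ?j))) \<le> 3 / real k" by simp
    qed (use \<epsilon> in auto)
    also have "\<dots> = c / 2 / sqrt (real k)"
    proof -
      have "real k = sqrt (real k) * sqrt (real k)" by simp
      then show ?thesis using C_pos sk by (simp add: \<epsilon>_def divide_simps power2_eq_square)
    qed
    finally have near: "lprob p k {ys\<in>bridges. \<bar>pos ys ?j\<bar> < 2 * int m} \<le> c / 2 / sqrt (real k)" .
    have "c / sqrt (real k) \<le> lprob p k bridges"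
      using k2 k by (intro return_prob_ge)
    also have "\<dots> \<le> lprob p k ({ys\<in>bridges. \<bar>pos ys ?j\<bar> < 2 * int m} \<union> {ys\<in>bridges. 2 * int m \<le> \<bar>pos ys ?j\<bar>})"
      by (rule lprob_mono) auto
    also have "\<dots> \<le> lprob p k {ys\<in>bridges. \<bar>pos ys ?j\<bar> < 2 * int m}
        + lprob p k {ys\<in>bridges. 2 * int m \<le> \<bar>pos ys ?j\<bar>}"
      by (simp add: measure_Un_le)
    also have "\<dots> \<le> c / 2 / sqrt (real k) + 2 * lprob p k (high_bridges m)"
      using near high_bridges_prob_ge[of ?j k p m] j by linarith
    finally have high: "c / 4 / sqrt (real k) \<le> lprob p k (high_bridges m)" by simp
    have "\<epsilon> * c / 8 = (\<epsilon> * sqrt (real k) / 2) * (c / 4 / sqrt (real k))"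
      using sk by simp
    also have "\<dots> \<le> real m * lprob p k (high_bridges m)"
      using m high \<epsilon> c_pos by (intro mult_mono) auto
    also have "\<dots> \<le> record_gap p k"
      using step k2 by (intro record_gap_ge_high_bridges) auto
    finally show ?thesis .
  qed
  moreover have "\<epsilon> * c / 8 > 0" using \<epsilon> c_pos by simp
  ultimately show ?thesis by blast
qed

text \<open>
  The renewal inequality bounds \<open>n * v n\<close> from below by a constant times the sum of the \<open>v j\<close> for
  which the complementary time \<open>n - j\<close> is large and satisfies the divisibility condition. The latter
  holds for every \<open>j\<close> with \<open>v j > 0\<close>.
\<close>

lemma weak_bridge_prob_ge:
  assumes step: "\<And>x. x \<in> set_pmf p \<Longrightarrow> x \<le> 1"
  shows "\<exists>b>0. \<exists>M\<^sub>0. \<forall>n\<ge>M\<^sub>0. int d dvd int n * a \<longrightarrow>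
     b * real n powr (-3/4) \<le> lprob p n (bridges \<inter> weak_pers)"
proof -
  let ?v = "\<lambda>n. lprob p n (bridges \<inter> weak_pers)"
  obtain \<eta> K0 where \<eta>: "\<eta> > 0"
    and gap: "\<And>k. k \<ge> K0 \<Longrightarrow> int d dvd int k * a \<Longrightarrow> \<eta> \<le> record_gap p k"
    using record_gap_bounded_below[OF step] by blast
  obtain b M1 where b: "b > 0" and M1: "\<And>M. M \<ge> M1 \<Longrightarrow> b * sqrt (real M) \<le> (\<Sum>n\<le>M. lprob p n bridges)"
    using sum_return_prob_ge by blast
  have sum_v: "sqrt b * real M powr (1/4) \<le> (\<Sum>j\<le>M. ?v j)" if "M \<ge> M1" for M
  proof -
    have "(sqrt b * real M powr (1/4))\<^sup>2 = b * sqrt (real M)"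
    proof -
      have "(real M powr (1/4))\<^sup>2 = sqrt (real M)"
        by (simp add: power2_eq_square powr_add[symmetric] powr_half_sqrt)
      then show ?thesis using b by (simp add: power_mult_distrib)
    qed
    also have "\<dots> \<le> (\<Sum>n\<le>M. lprob p n bridges)" using that by (rule M1)
    also have "\<dots> \<le> (\<Sum>j\<le>M. ?v j)\<^sup>2"
      unfolding power2_eq_square by (rule convolution_sum_ge[OF weak_bridge_convolution]) auto
    finally show ?thesis by (rule power2_le_imp_le) (simp add: sum_nonneg)
  qed
  define B where "B = \<eta> * sqrt b * (1 / 2) powr (1/4)"
  have "B * real n powr (-3/4) \<le> ?v n" if n: "n \<ge> 2 * (K0 + M1) + 2" "int d dvd int n * a" for n
  proof -
    \<comment> \<open>The summation stops where the bound on \<open>record_gap\<close> is still valid; \<open>M\<close> is at least \<open>n / 2\<close>.\<close>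
    define M where "M = n - (K0 + 1)"
    have M: "M \<ge> M1" "M < n" "n \<le> 2 * M" using n by (simp_all add: M_def)
    have "real n * (B * real n powr (-3/4)) = \<eta> * sqrt b * ((1 / 2) powr (1/4) * real n powr (1/4))"
      using n by (simp add: B_def mult.left_commute[of "real n"] powr_mult_base)
    also have "(1 / 2) powr (1/4) * real n powr (1/4) = (real n / 2) powr (1/4)"
      by (simp add: powr_mult[symmetric])
    also have "\<eta> * sqrt b * (real n / 2) powr (1/4) \<le> \<eta> * sqrt b * real M powr (1/4)"
    proof -
      have "real n \<le> real (2 * M)" using M(3) by (simp only: of_nat_le_iff)
      then show ?thesis using \<eta> b by (intro mult_left_mono powr_mono2) auto
    qed
    also have "\<dots> \<le> \<eta> * (\<Sum>j\<le>M. ?v j)"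
      using sum_v[OF M(1)] \<eta> by (simp add: mult.assoc)
    also have "\<dots> = (\<Sum>j\<le>M. ?v j * \<eta>)" by (simp add: sum_distrib_left mult.commute)
    also have "\<dots> \<le> (\<Sum>j\<le>M. ?v j * record_gap p (n - j))"
    proof (rule sum_mono)
      fix j assume j: "j \<in> {..M}"
      show "?v j * \<eta> \<le> ?v j * record_gap p (n - j)"
      proof (cases "?v j = 0")
        case False
        then have "0 < ?v j" by (simp add: zero_less_measure_iff)
        also have "?v j \<le> lprob p j bridges" by (rule lprob_mono) auto
        finally have "int d dvd int j * a" by (rule return_lattice)
        then have "int d dvd int n * a - int j * a" using n(2) by (intro dvd_diff)
        also have "int n * a - int j * a = int (n - j) * a"
          using j M by (simp add: of_nat_diff algebra_simps)
        finally have "\<eta> \<le> record_gap p (n - j)" using j M by (intro gap) (auto simp: M_def)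
        then show ?thesis by (intro mult_left_mono) auto
      qed simp
    qed
    also have "\<dots> \<le> (\<Sum>j<n. ?v j * record_gap p (n - j))"
      using M by (intro sum_mono2) (auto simp: record_gap_def intro!: mult_nonneg_nonneg sum_nonneg)
    also have "\<dots> \<le> real n * ?v n" by (rule record_renewal_inequality)
    finally show ?thesis using n by simp
  qed
  moreover have "B > 0" using \<eta> b by (simp add: B_def)
  ultimately show ?thesis by blast
qed

lemma positive_area_bridge_prob_ge:
  assumes step: "\<And>x. x \<in> set_pmf p \<Longrightarrow> x \<le> 1" and one: "1 \<in> set_pmf p"
    and down: "- int b \<in> set_pmf p" "b > 0"
  shows "\<exists>B>0. \<exists>M\<^sub>0. \<forall>n\<ge>M\<^sub>0. int d dvd int n * a \<longrightarrow>
     B * real n powr (-3/4) \<le> lprob p n (bridges \<inter> positive_area)"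
proof -
  obtain B M0 where B: "B > 0" and weak: "\<And>n. n \<ge> M0 \<Longrightarrow> int d dvd int n * a \<Longrightarrow>
     B * real n powr (-3/4) \<le> lprob p n (bridges \<inter> weak_pers)"
    using weak_bridge_prob_ge[OF step] by blast
  \<comment> \<open>This excursion climbs to height \<open>b\<close> in unit steps and returns to 0 in one step, so all its areas
     are positive.\<close>
  define tooth where "tooth = replicate b (1::int) @ [- int b]"
  have len: "length tooth = Suc b" by (simp add: tooth_def)
  have sum0: "sum_list tooth = 0" by (simp add: tooth_def sum_list_replicate)
  have pos: "0 \<le> pos tooth i" if "i \<le> Suc b" for i
    using that by (cases "i \<le> b") (auto simp: tooth_def pos_def sum_list_replicate le_Suc_eq)
  have pos1: "pos tooth 1 = 1"
    using down(2) by (cases b) (simp_all add: tooth_def pos_def)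
  have area: "0 < area tooth k" if "k \<in> {1..Suc b}" for k
  proof -
    have "pos tooth 1 \<le> area tooth k"
      unfolding area_def using that pos by (intro member_le_sum) auto
    with pos1 show ?thesis by simp
  qed
  define \<delta> where "\<delta> = lprob p (Suc b) {tooth}"
  have \<delta>: "\<delta> > 0"
  proof -
    have "tooth \<in> set_pmf (replicate_pmf (Suc b) p)"
      using one down len unfolding set_replicate_pmf by (auto simp: tooth_def)
    then show ?thesis unfolding \<delta>_def measure_pmf_single by (rule pmf_positive)
  qed
  also have "\<delta> \<le> lprob p (Suc b) bridges"
    unfolding \<delta>_def by (rule lprob_mono) (use sum0 in \<open>simp add: bridges_def\<close>)
  finally have tooth_lattice: "int d dvd int (Suc b) * a" by (rule return_lattice)
  have "\<delta> * B * real n powr (-3/4) \<le> lprob p n (bridges \<inter> positive_area)"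
    if n: "n \<ge> M0 + Suc b + 1" "int d dvd int n * a" for n
  proof -
    let ?m = "n - Suc b"
    have "int d dvd int n * a - int (Suc b) * a" using n(2) tooth_lattice by (rule dvd_diff)
    also have "int n * a - int (Suc b) * a = int ?m * a"
      using n by (simp add: of_nat_diff algebra_simps)
    finally have "B * real ?m powr (-3/4) \<le> lprob p ?m (bridges \<inter> weak_pers)"
      using n by (intro weak) auto
    moreover have "real n powr (-3/4) \<le> real ?m powr (-3/4)"
      using n by (intro powr_mono2') auto
    ultimately have "\<delta> * (B * real n powr (-3/4)) \<le> \<delta> * lprob p ?m (bridges \<inter> weak_pers)"
      using \<delta> B by (meson mult_left_mono less_imp_le order.trans)
    also have "\<dots> = lprob p n {zs. take (Suc b) zs \<in> {tooth} \<and> drop (Suc b) zs \<in> bridges \<inter> weak_pers}"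
      unfolding \<delta>_def using n by (intro lprob_split_prod'[symmetric]) simp
    also have "\<dots> \<le> lprob p n (bridges \<inter> positive_area)"
    proof (rule lprob_mono)
      fix zs :: "int list"
      assume zs: "length zs = n" "set zs \<subseteq> set_pmf p"
        "zs \<in> {zs. take (Suc b) zs \<in> {tooth} \<and> drop (Suc b) zs \<in> bridges \<inter> weak_pers}"
      define ys where "ys = drop (Suc b) zs"
      have eq: "zs = tooth @ ys" using zs(3) unfolding ys_def by (metis (mono_tags, lifting) append_take_drop_id mem_Collect_eq singletonD)
      have ys: "ys \<in> bridges \<inter> weak_pers" using zs(3) by (simp add: ys_def)
      have step': "\<forall>x\<in>set ys. x \<le> 1"
        using zs(2) step unfolding eq by auto
      have "zs \<in> bridges" using ys sum0 by (simp add: eq bridges_def)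
      moreover have "0 < area zs k" if k: "k \<in> {1..length zs}" for k
      proof (cases "k \<le> Suc b")
        case True
        with area k len show ?thesis by (simp add: eq area_append1)
      next
        case False
        then obtain k' where k': "k = Suc b + k'" by (metis le_add_diff_inverse nat_le_linear)
        then have "area zs k = area tooth (Suc b) + area ys k'"
          using area_append2[of tooth ys k'] len sum0 by (simp add: eq)
        moreover have "0 \<le> area ys k'"
          using k k' len by (intro weak_bridge_area_nonneg[OF step' ys]) (auto simp: eq)
        ultimately show ?thesis using area[of "Suc b"] by simp
      qed
      ultimately show "zs \<in> bridges \<inter> positive_area" by (simp add: positive_area_def)
    qed
    finally show ?thesis by (simp add: mult.assoc)
  qed
  moreover have "\<delta> * B > 0" using \<delta> B by simp
  ultimately show ?thesis by blast
qed

end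

section \<open>From the increments to their common law\<close>

lemma pmf_replicate_pmf:
  "pmf (replicate_pmf n p) xs = (if length xs = n then prod_list (map (pmf p) xs) else 0)"
proof (induction n arbitrary: xs)
  case 0
  then show ?case by (simp add: indicator_def)
next
  case (Suc n)
  have eq: "replicate_pmf (Suc n) p = map_pmf (\<lambda>(y, ys). y # ys) (pair_pmf p (replicate_pmf n p))"
    by (simp add: pair_pmf_def map_bind_pmf map_return_pmf)
  show ?case
  proof (cases xs)
    case Nil
    have "[] \<notin> set_pmf (replicate_pmf (Suc n) p)" by (simp only: set_replicate_pmf) simp
    with Nil show ?thesis by (simp add: set_pmf_iff del: replicate_pmf.simps)
  next
    case (Cons y ys)
    have "pmf (replicate_pmf (Suc n) p) (y # ys) = pmf (pair_pmf p (replicate_pmf n p)) (y, ys)"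
      unfolding eq using pmf_map_inj'[of "\<lambda>(y, ys). y # ys" _ "(y, ys)"] by (simp add: inj_def)
    then show ?thesis using Cons Suc by (simp add: pmf_pair del: replicate_pmf.simps)
  qed
qed

text \<open>
  Moves a countably valued random variable to the type of probability mass functions, where the law
  of a list of increments can be compared pointwise with \<open>replicate_pmf\<close>.
\<close>

lemma measure_pmf_of_discrete_variable:
  fixes Y :: "'a \<Rightarrow> 'b :: countable"
  assumes "prob_space M" "Y \<in> measurable M (count_space UNIV)"
  obtains q where "measure_pmf q = distr M (count_space UNIV) Y"
proof -
  let ?D = "distr M (count_space UNIV) Y"
  interpret D: prob_space ?D using assms by (rule prob_space.prob_space_distr)
  have "AE x in ?D. measure ?D {x} \<noteq> 0"
    by (rule iffD2[OF D.AE_support_countable]) (auto intro!: exI[of _ UNIV])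
  then have "measure_pmf (Abs_pmf ?D) = ?D"
    by (intro Abs_pmf_inverse) (simp add: D.prob_space_axioms)
  then show ?thesis by (rule that)
qed

lemma iid_increments_measurable:
  assumes "prob_space M" "iid_increments M X" "i \<ge> 1"
  shows "X i \<in> measurable M (count_space UNIV)"
proof -
  interpret prob_space M by fact
  have "indep_vars (\<lambda>_. count_space UNIV) X {1..}"
    using assms(2) unfolding iid_increments_def by blast
  with assms(3) show ?thesis unfolding indep_vars_def by auto
qed

text \<open>
  Both laws live on the countable set of integer lists, so it suffices to compare point masses, and
  these factorize by independence.
\<close>

lemma iid_increments_law:
  assumes "prob_space M" "iid_increments M X"
  obtains p where "measure_pmf p = distr M (count_space UNIV) (X 1)"
    "\<And>n B. measure M {\<omega>\<in>space M. map (\<lambda>i. X i \<omega>) [1..<Suc n] \<in> B} = lprob p n B"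
proof -
  interpret prob_space M by fact
  have indep: "indep_vars (\<lambda>_. count_space UNIV) X {1..}"
    and distr: "\<And>i. i \<ge> 1 \<Longrightarrow> distr M (count_space UNIV) (X i) = distr M (count_space UNIV) (X 1)"
    using assms(2) unfolding iid_increments_def by blast+
  have meas: "X i \<in> measurable M (count_space UNIV)" if "i \<ge> 1" for i
    using iid_increments_measurable[OF assms that] .
  obtain p where p: "measure_pmf p = distr M (count_space UNIV) (X 1)"
    using measure_pmf_of_discrete_variable[OF assms(1) meas[of 1]] by auto
  have single: "prob (X i -` {x} \<inter> space M) = pmf p x" if "i \<ge> 1" for i x
  proof -
    have "pmf p x = measure (distr M (count_space UNIV) (X i)) {x}"
      by (simp add: measure_pmf_single[symmetric] p distr[OF that])
    then show ?thesis using meas[OF that] by (simp add: measure_distr)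
  qed
  have law: "measure M {\<omega>\<in>space M. map (\<lambda>i. X i \<omega>) [1..<Suc n] \<in> B} = lprob p n B" for n B
  proof -
    define Y where "Y \<omega> = map (\<lambda>i. X i \<omega>) [1..<Suc n]" for \<omega>
    have event: "Y -` {xs} \<inter> space M =
        (if length xs = n then (\<Inter>i\<in>{1..n}. X i -` {xs ! (i - 1)} \<inter> space M) \<inter> space M else {})" for xs
    proof -
      have "Y \<omega> = xs \<longleftrightarrow> length xs = n \<and> (\<forall>i\<in>{..<n}. X (Suc i) \<omega> = xs ! i)" for \<omega>
        by (auto simp: Y_def list_eq_iff_nth_eq simp del: upt_Suc)
      moreover have "(\<forall>i\<in>{..<n}. X (Suc i) \<omega> = xs ! i) \<longleftrightarrow> (\<forall>i\<in>{1..n}. X i \<omega> = xs ! (i - 1))" for \<omega>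
        unfolding image_Suc_lessThan[symmetric] by simp
      ultimately show ?thesis by auto
    qed
    have sets: "(\<Inter>i\<in>{1..n}. X i -` {xs ! (i - 1)} \<inter> space M) \<inter> space M \<in> events" for xs
    proof (cases "n = 0")
      case False
      then show ?thesis
        by (intro sets.Int sets.finite_INT measurable_sets[OF meas]) auto
    qed simp
    have "Y \<in> measurable M (count_space UNIV)"
    proof (subst measurable_count_space_eq_countable)
      show "Y \<in> space M \<rightarrow> UNIV \<and> (\<forall>xs\<in>UNIV. Y -` {xs} \<inter> space M \<in> events)"
        unfolding event using sets by simp
    qed simp
    then obtain q where q: "measure_pmf q = distr M (count_space UNIV) Y"
      using measure_pmf_of_discrete_variable[OF assms(1)] by blast
    have "q = replicate_pmf n p"
    proof (rule pmf_eqI)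
      fix xs
      have "pmf q xs = prob (Y -` {xs} \<inter> space M)"
        using \<open>Y \<in> measurable M (count_space UNIV)\<close>
        by (simp add: measure_pmf_single[symmetric] q measure_distr)
      also have "\<dots> = pmf (replicate_pmf n p) xs"
      proof (cases "length xs = n")
        case True
        show ?thesis
        proof (cases "n = 0")
          case n: True
          with \<open>length xs = n\<close> show ?thesis
            by (simp add: event pmf_replicate_pmf prob_space)
        next
          case False
          then have "1 \<in> {1..n}" by simp
          then have "(\<Inter>i\<in>{1..n}. X i -` {xs ! (i - 1)} \<inter> space M) \<inter> space M = (\<Inter>i\<in>{1..n}. X i -` {xs ! (i - 1)} \<inter> space M)"
            by blast
          then have "prob (Y -` {xs} \<inter> space M) = prob (\<Inter>i\<in>{1..n}. X i -` {xs ! (i - 1)} \<inter> space M)"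
            by (simp only: event True simp_thms if_True)
          also have "\<dots> = (\<Prod>i\<in>{1..n}. prob (X i -` {xs ! (i - 1)} \<inter> space M))"
            by (rule indep_varsD[OF indep]) (use False in auto)
          also have "\<dots> = (\<Prod>i\<in>{1..n}. pmf p (xs ! (i - 1)))"
            by (intro prod.cong refl single) auto
          also have "\<dots> = (\<Prod>i<n. pmf p (xs ! i))"
            by (rule prod.reindex_bij_witness[of _ Suc "\<lambda>i. i - 1"]) auto
          also have "\<dots> = prod_list (map (pmf p) xs)"
            using True by (simp add: prod.list_conv_set_nth atLeast0LessThan)
          finally show ?thesis using True by (simp add: pmf_replicate_pmf)
        qed
      qed (simp add: event pmf_replicate_pmf)
      finally show "pmf q xs = pmf (replicate_pmf n p) xs" .
    qed
    then have "lprob p n B = measure (distr M (count_space UNIV) Y) B" by (simp add: q[symmetric])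
    also have "\<dots> = prob (Y -` B \<inter> space M)"
      using \<open>Y \<in> measurable M (count_space UNIV)\<close> by (simp add: measure_distr)
    also have "Y -` B \<inter> space M = {\<omega>\<in>space M. map (\<lambda>i. X i \<omega>) [1..<Suc n] \<in> B}"
      by (auto simp: Y_def)
    finally show ?thesis by simp
  qed
  show ?thesis by (rule that[OF p law])
qed

lemma walk_eq_pos:
  assumes "k \<le> n"
  shows "walk X k \<omega> = pos (map (\<lambda>i. X i \<omega>) [1..<Suc n]) k"
proof -
  have "take k [1..<Suc n] = [1..<Suc k]" using assms by (simp add: take_upt del: upt_Suc)
  then have "pos (map (\<lambda>i. X i \<omega>) [1..<Suc n]) k = sum_list (map (\<lambda>i. X i \<omega>) [1..<Suc k])"
    by (simp only: pos_def take_map)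
  also have "\<dots> = (\<Sum>i\<in>{1..<Suc k}. X i \<omega>)" by (simp only: sum_list_distinct_conv_sum_set distinct_upt set_upt)
  finally show ?thesis by (simp add: walk_def atLeastLessThanSuc_atLeastAtMost)
qed

lemma integrated_walk_eq_area:
  assumes "k \<le> n"
  shows "integrated_walk X k \<omega> = area (map (\<lambda>i. X i \<omega>) [1..<Suc n]) k"
  unfolding integrated_walk_def area_def using assms
  by (intro sum.cong refl walk_eq_pos) auto


lemma bridge_persistence_eq:
  assumes M: "prob_space M"
    and law: "\<And>n B. measure M {\<omega>\<in>space M. map (\<lambda>i. X i \<omega>) [1..<Suc n] \<in> B} = lprob p n B"
  shows "\<P>(\<omega> in M. walk X n \<omega> = 0) = lprob p n bridges"
    and "n \<ge> 1 \<Longrightarrow>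
      bridge_persistence M X n = lprob p n (bridges \<inter> positive_area) / lprob p n bridges"
proof -
  define Y where "Y \<omega> = map (\<lambda>i. X i \<omega>) [1..<Suc n]" for \<omega>
  have len: "length (Y \<omega>) = n" for \<omega> by (simp add: Y_def del: upt_Suc)
  have zero: "walk X n \<omega> = 0 \<longleftrightarrow> Y \<omega> \<in> bridges" for \<omega>
    using walk_eq_pos[of n n X \<omega>] len by (simp only: Y_def[symmetric] bridges_def pos_length) simp
  show bridge: "\<P>(\<omega> in M. walk X n \<omega> = 0) = lprob p n bridges"
    by (simp only: zero Y_def law)
  assume n: "n \<ge> 1"
  have "Min ((\<lambda>k. integrated_walk X k \<omega>) ` {1..n}) > 0 \<longleftrightarrow> Y \<omega> \<in> positive_area" for \<omega>
  proof -
    have "(\<lambda>k. integrated_walk X k \<omega>) ` {1..n} = (\<lambda>k. area (Y \<omega>) k) ` {1..n}"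
      unfolding Y_def by (intro image_cong refl integrated_walk_eq_area) simp
    then show ?thesis using n len by (simp add: positive_area_def)
  qed
  then have "\<P>(\<omega> in M. Min ((\<lambda>k. integrated_walk X k \<omega>) ` {1..n}) > 0 \<and> walk X n \<omega> = 0)
     = lprob p n (bridges \<inter> positive_area)"
    by (simp only: zero Y_def law flip: Int_iff) (simp only: Int_commute)
  then show "bridge_persistence M X n = lprob p n (bridges \<inter> positive_area) / lprob p n bridges"
    unfolding bridge_persistence_def cond_prob_def bridge by simp
qed

lemma eventually_at_top_along:
  "eventually P (at_top_along D) \<longleftrightarrow> (\<exists>N. \<forall>n\<ge>N. n \<in> D \<longrightarrow> P n)"
  by (simp add: at_top_along_def eventually_inf_principal eventually_at_top_linorder)

text \<open>
  A downward step exists because a nonnegative step with mean zero would vanish almost surely.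
\<close>

lemma right_continuous_steps:
  assumes M: "prob_space M" and p: "measure_pmf p = distr M (count_space UNIV) Y"
    and Y: "Y \<in> measurable M (count_space UNIV)"
    and rc: "right_continuous M Y"
    and int: "integrable (measure_pmf p) real_of_int"
    and mean: "(\<integral>x. real_of_int x \<partial>measure_pmf p) = 0"
  shows "\<And>x. x \<in> set_pmf p \<Longrightarrow> x \<le> 1" "1 \<in> set_pmf p"
    "\<exists>b>0. - int b \<in> set_pmf p"
proof -
  have prob: "\<P>(\<omega> in M. Y \<omega> \<in> B) = measure_pmf.prob p B" for B
    unfolding p using Y by (simp add: measure_distr vimage_def Int_def conj_commute)
  have pos: "measure_pmf.prob p {0<..} > 0"
    using rc prob[of "{0<..}"] by (simp add: right_continuous_def)
  have "\<P>(\<omega> in M. Y \<omega> = 1 \<and> Y \<omega> > 0) = measure_pmf.prob p {1}"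
    using prob[of "{1}"] by (simp add: conj_commute cong: conj_cong)
  then have "measure_pmf.prob p {1} / measure_pmf.prob p {0<..} = 1"
    using rc prob[of "{0<..}"] by (simp add: right_continuous_def cond_prob_def)
  then have one: "pmf p 1 = measure_pmf.prob p {0<..}"
    using pos by (simp add: measure_pmf_single)
  with pos show "1 \<in> set_pmf p" by (simp add: set_pmf_iff)
  show le1: "x \<le> 1" if x: "x \<in> set_pmf p" for x
  proof (rule ccontr)
    assume "\<not> x \<le> 1"
    then have "measure_pmf.prob p {1, x} = pmf p 1 + pmf p x"
      by (subst measure_measure_pmf_finite) auto
    moreover have "measure_pmf.prob p {1, x} \<le> measure_pmf.prob p {0<..}"
      using \<open>\<not> x \<le> 1\<close> by (intro measure_pmf.finite_measure_mono) auto
    ultimately show False using one pmf_positive[OF x] by simp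
  qed
  show "\<exists>b>0. - int b \<in> set_pmf p"
  proof (rule ccontr)
    assume neg: "\<not> ?thesis"
    have nonneg: "0 \<le> x" if "x \<in> set_pmf p" for x
    proof (rule ccontr)
      assume "\<not> 0 \<le> x"
      with neg that show False by (auto dest!: spec[of _ "nat (- x)"])
    qed
    have "AE x in measure_pmf p. real_of_int x = 0"
      using integral_nonneg_eq_0_iff_AE[OF int] mean nonneg by (simp add: AE_measure_pmf_iff)
    then have "real_of_int 1 = 0"
      unfolding AE_measure_pmf_iff using \<open>1 \<in> set_pmf p\<close> by (rule bspec)
    then show False by simp
  qed
qed

theorem proposition1:
  fixes M :: "'a measure" and X :: "nat \<Rightarrow> 'a \<Rightarrow> int"
  assumes "prob_space M"
    and "iid_increments M X"
    and "integrable M (\<lambda>\<omega>. real_of_int (walk X 1 \<omega>))"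
    and "prob_space.expectation M (\<lambda>\<omega>. real_of_int (walk X 1 \<omega>)) = 0"
    and "integrable M (\<lambda>\<omega>. (real_of_int (walk X 1 \<omega>)
           - prob_space.expectation M (\<lambda>\<omega>. real_of_int (walk X 1 \<omega>)))\<^sup>2)"
  shows "bridge_persistence M X
           \<in> O[at_top_along (return_times M X)](\<lambda>N. real N powr (-1/4))
       \<and> (right_continuous M (walk X 1) \<longrightarrow>
           bridge_persistence M X
             \<in> \<Theta>[at_top_along (return_times M X)](\<lambda>N. real N powr (-1/4)))"
proof -
  let ?D = "return_times M X" and ?f = "bridge_persistence M X"
  obtain p where p: "measure_pmf p = distr M (count_space UNIV) (X 1)"
    and law: "\<And>n B. measure M {\<omega>\<in>space M. map (\<lambda>i. X i \<omega>) [1..<Suc n] \<in> B} = lprob p n B"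
    using iid_increments_law[OF assms(1,2)] by blast
  have X1: "walk X 1 = X 1" by (simp add: walk_def fun_eq_iff)
  have meas: "X 1 \<in> measurable M (count_space UNIV)"
    using iid_increments_measurable[OF assms(1,2)] by simp
  have moments: "integrable (measure_pmf p) real_of_int" "(\<integral>x. real_of_int x \<partial>measure_pmf p) = 0"
    "integrable (measure_pmf p) (\<lambda>x. (real_of_int x)\<^sup>2)"
    unfolding p using assms(3-5)[unfolded X1] meas
    by (simp_all add: integrable_distr_eq integral_distr)
  have D: "n \<in> ?D \<longleftrightarrow> n \<ge> 1 \<and> lprob p n bridges > 0" for n
    by (simp add: return_times_def bridge_persistence_eq(1)[OF assms(1) law])
  have f: "?f n = lprob p n (bridges \<inter> positive_area) / lprob p n bridges" if "n \<in> ?D" for n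
    using bridge_persistence_eq(2)[OF assms(1) law] that D by blast
  show ?thesis
  \<comment> \<open>The walk that never moves has all areas equal to zero, so the probability in question is zero;
     it is not right-continuous.\<close>
  proof (cases "set_pmf p = {0}")
    case True
    have "lprob p n (bridges \<inter> positive_area) = 0" if "n \<ge> 1" for n
    proof -
      have "lprob p n (bridges \<inter> positive_area) \<le> lprob p n {}"
      proof (rule lprob_mono)
        fix xs assume xs: "length xs = n" "set xs \<subseteq> set_pmf p" "xs \<in> bridges \<inter> positive_area"
        then have "take 1 xs = [0]" using True that by (cases xs) auto
        then have "area xs 1 = 0" by (simp add: area_def pos_def)
        moreover have "1 \<in> {1..length xs}" using xs(1) that by simp
        with xs(3) have "0 < area xs 1" unfolding positive_area_def by blast
        ultimately show "xs \<in> {}" by linarith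
      qed
      then show ?thesis by (simp add: measure_le_0_iff)
    qed
    then have "eventually (\<lambda>n. ?f n = 0) (at_top_along ?D)"
      unfolding eventually_at_top_along using f D by auto
    then have "?f \<in> O[at_top_along ?D](\<lambda>N. real N powr (-1/4))"
      by (intro bigoI[of _ 1]) (simp add: eventually_mono)
    moreover have "\<not> right_continuous M (walk X 1)"
      unfolding X1 using right_continuous_steps(2)[OF assms(1) p meas _ moments(1,2)] True by auto
    ultimately show ?thesis by blast
  next
    case False
    interpret centered_step p by unfold_locales (fact moments False)+
    obtain d a C c N0 where "d > 0" "C > 0" "c > 0"
      and C: "\<And>n x. n \<ge> 1 \<Longrightarrow> lprob p n {xs. sum_list xs = x} \<le> C / sqrt (real n)"
      and "\<And>n. lprob p n {xs. sum_list xs = 0} > 0 \<Longrightarrow> int d dvd int n * a"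
      and "\<And>n. n \<ge> N0 \<Longrightarrow> int d dvd int n * a \<Longrightarrow> c / sqrt (real n) \<le> lprob p n {xs. sum_list xs = 0}"
      by (rule local_limit_estimates) (rule that; assumption)
    then interpret lattice_step p d a C c N0
      by (intro lattice_step.intro) (simp_all only: bridges_def)
    obtain K M0 where K: "\<And>n. n \<ge> M0 \<Longrightarrow> lprob p n (bridges \<inter> strict_pers) \<le> K * real n powr (-3/4)"
      using strict_bridge_prob_le by blast
    have half: "real n powr (-3/4) * sqrt (real n) = real n powr (-1/4)" if "n \<ge> 1" for n
      using that by (simp add: powr_half_sqrt[symmetric] powr_add[symmetric])
    have upper: "?f \<in> O[at_top_along ?D](\<lambda>N. real N powr (-1/4))"
    proof (rule bigoI)
      show "eventually (\<lambda>n. norm (?f n) \<le> (\<bar>K\<bar> / c) * norm (real n powr (-1/4))) (at_top_along ?D)"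
        unfolding eventually_at_top_along
      proof (intro exI allI impI)
        fix n assume n: "n \<ge> max M0 N0" "n \<in> ?D"
        then have n1: "n \<ge> 1" "0 < lprob p n bridges" by (auto simp: D)
        have "lprob p n (bridges \<inter> positive_area) \<le> lprob p n (bridges \<inter> strict_pers)"
          by (rule lprob_mono) (auto simp: positive_area_def strict_pers_def)
        also have "\<dots> \<le> \<bar>K\<bar> * real n powr (-3/4)"
          using K[of n] n by (smt (verit, best) max.bounded_iff mult_right_mono powr_ge_zero)
        finally have num: "lprob p n (bridges \<inter> positive_area) \<le> \<bar>K\<bar> * real n powr (-3/4)" .
        have den: "c / sqrt (real n) \<le> lprob p n bridges"
          using n return_lattice[OF n1(2)] by (intro return_prob_ge) auto
        have "?f n \<le> (\<bar>K\<bar> * real n powr (-3/4)) / (c / sqrt (real n))"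
          unfolding f[OF n(2)] using num den c_pos n1 by (intro frac_le) auto
        also have "\<dots> = \<bar>K\<bar> / c * real n powr (-1/4)"
          using half[OF n1(1)] by (simp add: field_simps)
        finally show "norm (?f n) \<le> (\<bar>K\<bar> / c) * norm (real n powr (-1/4))"
          by (simp add: f[OF n(2)])
      qed
    qed
    have lower: "?f \<in> \<Omega>[at_top_along ?D](\<lambda>N. real N powr (-1/4))"
      if rc: "right_continuous M (walk X 1)"
    proof -
      note steps = right_continuous_steps[OF assms(1) p meas rc[unfolded X1] moments(1,2)]
      obtain b where b: "b > 0" "- int b \<in> set_pmf p" using steps(3) by blast
      obtain B M1 where B: "B > 0" and M1: "\<And>n. n \<ge> M1 \<Longrightarrow> int d dvd int n * a \<Longrightarrow>
          B * real n powr (-3/4) \<le> lprob p n (bridges \<inter> positive_area)"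
        using positive_area_bridge_prob_ge[OF steps(1,2) b(2,1)] by blast
      show ?thesis
      proof (rule landau_omega.bigI)
        show "B / C > 0" using B C_pos by simp
        show "eventually (\<lambda>n. norm (?f n) \<ge> (B / C) * norm (real n powr (-1/4))) (at_top_along ?D)"
          unfolding eventually_at_top_along
        proof (intro exI allI impI)
          fix n assume n: "n \<ge> M1" "n \<in> ?D"
          then have n1: "n \<ge> 1" "0 < lprob p n bridges" by (auto simp: D)
          have num: "B * real n powr (-3/4) \<le> lprob p n (bridges \<inter> positive_area)"
            using n(1) return_lattice[OF n1(2)] by (rule M1)
          have den: "lprob p n bridges \<le> C / sqrt (real n)"
            using C[OF n1(1)] by (simp add: bridges_def)
          have "(B / C) * real n powr (-1/4) = (B * real n powr (-3/4)) / (C / sqrt (real n))"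
            using half[OF n1(1)] by (simp add: field_simps)
          also have "\<dots> \<le> ?f n"
            unfolding f[OF n(2)] using num den n1 by (intro frac_le) auto
          finally show "norm (?f n) \<ge> (B / C) * norm (real n powr (-1/4))"
            by (simp add: f[OF n(2)])
        qed
      qed
    qed
    show ?thesis using upper lower by (auto intro: bigthetaI)
  qed
qed

end
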